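(* Let $\Lambda$ be a Borel probability measure on $(\mathbb{M}^{ac},\rho_{var})$ and let $(\mathcal{E},\mathcal{D}(\mathcal{E}))$ be a symmetric Dirichlet form on $L^2(\mathbb{M}^{ac},\Lambda)$. Assume that $(\mathcal{D}(\mathcal{E}),\mathcal{E}_1^{1/2})$ has a dense subspace consisting of quasi-continuous functions, and that additionally one of the following holds: (1) there exists a constant $C\in(0,\infty)$ such that $$\mathcal{E}(u,u)\le C\Big(\sup_{\mu\in\mathbb{M}^{ac}}\|D^E u(\mu)\|^2_{L^1(\mu)+L^\infty(\mu)}+\|u\|_\infty^2\Big),\qquad u\in\mathscr{X};$$ (2) $\Lambda(\mathscr{P}^{ac})=1$ and there exists a constant $C\in(0,\infty)$ such that $$\mathcal{E}(u,u)\le C\Big(\sup_{\mu\in\mathscr{P}^{ac}}\|\tilde D^E u(\mu)\|^2_{L^\infty(\mu)}+\|u\|_\infty^2\Big),\qquad u\in\mathscr{X}.$$ Then $(\mathcal{E},\mathcal{D}(\mathcal{E}))$ is quasi-regular. In case (2), $(\mathcal{E},\mathcal{D}(\mathcal{E}))$ is also quasi-regular as a Dirichlet form on $L^2(\mathscr{P}^{ac},\Lambda)$.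
   Context: Let $(M,\rho)$ be a Polish space and $\lambda\neq 0$ a $\sigma$-finite Radon measure on $M$. Let $\mathbb{M}$ be the set of finite Borel measures on $M$, $\mathscr{P}$ the set of Borel probability measures, $\mathbb{M}^{ac}=\{\mu\in\mathbb{M}:\mu\ll\lambda\}$, $\mathscr{P}^{ac}=\{\mu\in\mathscr{P}:\mu\ll\lambda\}$, $h_\mu=d\mu/d\lambda$, and $\rho_{var}(\mu,\nu)=\lambda(|h_\mu-h_\nu|)$ (total variation distance); $\mathbb{M}^{ac},\mathscr{P}^{ac}$ are Polish under $\rho_{var}$ and $\mathscr{P}^{ac}$ is closed in $\mathbb{M}^{ac}$. $\mathscr{X}$ is the class of cylinder functions $u(\mu)=g(\mu(f_1),\dots,\mu(f_n))$ on $\mathbb{M}$ with $n\in\mathbb{N}$, $f_i\in C_b(M)$, $g\in C^1_b(\mathbb{R}^n)$; for such $u$, $D^Eu(\mu)(x)=\sum_i\partial_ig(\mu(f_1),\dots,\mu(f_n))f_i(x)$ (extrinsic derivative, $D^Eu(\mu)(x)=\lim_{\varepsilon\downarrow0}\frac{u(\mu+\varepsilon\delta_x)-u(\mu)}{\varepsilon}$), and for $\mu\in\mathscr{P}$, $\tilde D^Eu(\mu)(x)=\sum_i\partial_ig(\mu(f_1),\dots,\mu(f_n))(f_i(x)-\mu(f_i))$ (convexity extrinsic derivative, $\lim_{\varepsilon\downarrow0}\frac{u((1-\varepsilon)\mu+\varepsilon\delta_x)-u(\mu)}{\varepsilon}$). $\|u\|_\infty$ is the sup norm; $\|f\|_{L^1(\mu)+L^\infty(\mu)}=\inf\{\|g\|_{L^1(\mu)}+\|k\|_{L^\infty(\mu)}: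 f=g+k\}$. Elements of $\mathscr{X}$ are regarded (restricted to $\mathbb{M}^{ac}$) as elements of $L^2(\Lambda)$, with the convention $\mathcal{E}(u,u)=\infty$ if $u\notin\mathcal{D}(\mathcal{E})$. A symmetric Dirichlet form is a densely defined, nonnegative, symmetric, closed bilinear form with the Markov property $\mathcal{E}(u^+\wedge1)\le\mathcal{E}(u)$; $\mathcal{E}_1(u,v)=\mathcal{E}(u,v)+\Lambda(uv)$. For open $O$, $\mathrm{Cap}_1(O)=\inf\{\mathcal{E}_1(u,u):u\in\mathcal{D}(\mathcal{E}),u\ge1\ \Lambda\text{-a.e. on }O\}$, extended to arbitrary sets by outer approximation with open sets. A nest is an increasing sequence of closed sets $K_n$ with $\mathrm{Cap}_1(K_n^c)\to0$; $u$ is quasi-continuous if there is a nest with $u|_{K_n}$ continuous for all $n$. The form is quasi-regular if: (Q1) there is a nest of compact sets; (Q2) $\mathcal{D}(\mathcal{E})$ has an $\mathcal{E}_1^{1/2}$-dense subspace of quasi-continuous functions; (Q3) there are a set $N$ with $\mathrm{Cap}_1(N)=0$ and quasi-continuous $u_n\in\mathcal{D}(\mathcal{E})$ separating the points of the complement of $N$. *)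

theory Defs
  imports "HOL-Analysis.Analysis" "HOL-Probability.Probability"
begin

text \<open>M is modelled by a type of class polish_space; Borel measures on M are values of
type 'a measure whose sigma-algebra is the Borel sigma-algebra.\<close>

definition radon_measure :: "'a::topological_space measure \<Rightarrow> bool" where
  "radon_measure lam \<longleftrightarrow>
     (\<forall>x. \<exists>U. open U \<and> x \<in> U \<and> emeasure lam U < \<infinity>) \<and>
     (\<forall>A\<in>sets lam. emeasure lam A = (SUP K\<in>{K. compact K \<and> K \<subseteq> A}. emeasure lam K))"

definition fin_meas :: "'a::topological_space measure set" where
  "fin_meas = {mu. sets mu = sets borel \<and> finite_measure mu}"

definition Mac :: "'a::topological_space measure \<Rightarrow> 'a measure set" where
  "Mac lam = {mu \<in> fin_meas. absolutely_continuous lam mu}"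

definition Pac :: "'a::topological_space measure \<Rightarrow> 'a measure set" where
  "Pac lam = {mu \<in> Mac lam. emeasure mu (space mu) = 1}"

definition dens :: "'a measure \<Rightarrow> 'a measure \<Rightarrow> 'a \<Rightarrow> real" where
  "dens lam mu = (\<lambda>x. enn2real (RN_deriv lam mu x))"

definition rho_var :: "'a measure \<Rightarrow> 'a measure \<Rightarrow> 'a measure \<Rightarrow> real" where
  "rho_var lam mu nu = (\<integral>x. \<bar>dens lam mu x - dens lam nu x\<bar> \<partial>lam)"

definition Mac_top :: "'a::topological_space measure \<Rightarrow> 'a measure topology" where
  "Mac_top lam = Metric_space.mtopology (Mac lam) (rho_var lam)"

definition borel_of :: "'b topology \<Rightarrow> 'b measure" where
  "borel_of X = sigma (topspace X) {U. openin X U}"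

text \<open>Elements of L^2(Lambda) are represented by (measurable, square integrable) functions;
the domain D is a set of such functions closed under Lambda-a.e. modification and E
depends only on Lambda-a.e. classes.\<close>

definition L2 :: "'b measure \<Rightarrow> ('b \<Rightarrow> real) set" where
  "L2 N = {u. u \<in> borel_measurable N \<and> integrable N (\<lambda>x. (u x)^2)}"

definition fdiff :: "('b \<Rightarrow> real) \<Rightarrow> ('b \<Rightarrow> real) \<Rightarrow> 'b \<Rightarrow> real" where
  "fdiff u v = (\<lambda>x. u x - v x)"

definition E1 :: "'b measure \<Rightarrow> (('b \<Rightarrow> real) \<Rightarrow> ('b \<Rightarrow> real) \<Rightarrow> real)
    \<Rightarrow> ('b \<Rightarrow> real) \<Rightarrow> ('b \<Rightarrow> real) \<Rightarrow> real" where
  "E1 N E u v = E u v + (\<integral>x. u x * v x \<partial>N)"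

definition sym_dirichlet_form :: "'b measure \<Rightarrow> (('b \<Rightarrow> real) \<Rightarrow> ('b \<Rightarrow> real) \<Rightarrow> real)
    \<Rightarrow> ('b \<Rightarrow> real) set \<Rightarrow> bool" where
  "sym_dirichlet_form N E D \<longleftrightarrow>
     D \<subseteq> L2 N \<and>
     (\<forall>u\<in>D. \<forall>v. v \<in> borel_measurable N \<and> (AE x in N. u x = v x) \<longrightarrow> v \<in> D) \<and>
     (\<lambda>x. 0) \<in> D \<and>
     (\<forall>u\<in>D. \<forall>v\<in>D. (\<lambda>x. u x + v x) \<in> D) \<and>
     (\<forall>c. \<forall>u\<in>D. (\<lambda>x. c * u x) \<in> D) \<and>
     (\<forall>u\<in>D. \<forall>u'\<in>D. \<forall>v\<in>D. (AE x in N. u x = u' x) \<longrightarrow> E u v = E u' v) \<and>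
     (\<forall>u\<in>D. \<forall>v\<in>D. E u v = E v u) \<and>
     (\<forall>u\<in>D. \<forall>v\<in>D. \<forall>w\<in>D. E (\<lambda>x. u x + v x) w = E u w + E v w) \<and>
     (\<forall>c. \<forall>u\<in>D. \<forall>v\<in>D. E (\<lambda>x. c * u x) v = c * E u v) \<and>
     (\<forall>u\<in>D. 0 \<le> E u u) \<and>
     (\<forall>f\<in>L2 N. \<forall>e>0. \<exists>u\<in>D. (\<integral>x. (f x - u x)^2 \<partial>N) < e) \<and>
     (\<forall>u. (\<forall>n. u n \<in> D) \<and>
          (\<forall>e>0. \<exists>M. \<forall>m\<ge>M. \<forall>n\<ge>M. E1 N E (fdiff (u m) (u n)) (fdiff (u m) (u n)) < e)
        \<longrightarrow> (\<exists>v\<in>D. (\<lambda>n. E1 N E (fdiff (u n) v) (fdiff (u n) v)) \<longlonglongrightarrow> 0)) \<and>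
     (\<forall>u\<in>D. (\<lambda>x. min (max (u x) 0) 1) \<in> D \<and>
        E (\<lambda>x. min (max (u x) 0) 1) (\<lambda>x. min (max (u x) 0) 1) \<le> E u u)"

definition cap1_open :: "'b measure \<Rightarrow> (('b \<Rightarrow> real) \<Rightarrow> ('b \<Rightarrow> real) \<Rightarrow> real)
    \<Rightarrow> ('b \<Rightarrow> real) set \<Rightarrow> 'b set \<Rightarrow> ennreal" where
  "cap1_open N E D U =
     (INF u\<in>{u\<in>D. AE x in N. x \<in> U \<longrightarrow> 1 \<le> u x}. ennreal (E1 N E u u))"

definition cap1 :: "'b topology \<Rightarrow> 'b measure \<Rightarrow> (('b \<Rightarrow> real) \<Rightarrow> ('b \<Rightarrow> real) \<Rightarrow> real)
    \<Rightarrow> ('b \<Rightarrow> real) set \<Rightarrow> 'b set \<Rightarrow> ennreal" where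
  "cap1 X N E D A = (INF U\<in>{U. openin X U \<and> A \<subseteq> U}. cap1_open N E D U)"

definition nest :: "'b topology \<Rightarrow> 'b measure \<Rightarrow> (('b \<Rightarrow> real) \<Rightarrow> ('b \<Rightarrow> real) \<Rightarrow> real)
    \<Rightarrow> ('b \<Rightarrow> real) set \<Rightarrow> (nat \<Rightarrow> 'b set) \<Rightarrow> bool" where
  "nest X N E D K \<longleftrightarrow> incseq K \<and> (\<forall>n. closedin X (K n)) \<and>
     (\<lambda>n. cap1 X N E D (topspace X - K n)) \<longlonglongrightarrow> 0"

definition quasi_continuous :: "'b topology \<Rightarrow> 'b measure \<Rightarrow> (('b \<Rightarrow> real) \<Rightarrow> ('b \<Rightarrow> real) \<Rightarrow> real)
    \<Rightarrow> ('b \<Rightarrow> real) set \<Rightarrow> ('b \<Rightarrow> real) \<Rightarrow> bool" where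
  "quasi_continuous X N E D u \<longleftrightarrow>
     (\<exists>K. nest X N E D K \<and> (\<forall>n. continuous_map (subtopology X (K n)) euclideanreal u))"

definition has_dense_qc_subspace :: "'b topology \<Rightarrow> 'b measure \<Rightarrow> (('b \<Rightarrow> real) \<Rightarrow> ('b \<Rightarrow> real) \<Rightarrow> real)
    \<Rightarrow> ('b \<Rightarrow> real) set \<Rightarrow> bool" where
  "has_dense_qc_subspace X N E D \<longleftrightarrow>
     (\<exists>S. S \<subseteq> D \<and> (\<lambda>x. 0) \<in> S \<and>
        (\<forall>u\<in>S. \<forall>v\<in>S. (\<lambda>x. u x + v x) \<in> S) \<and> (\<forall>c. \<forall>u\<in>S. (\<lambda>x. c * u x) \<in> S) \<and>
        (\<forall>u\<in>S. quasi_continuous X N E D u) \<and>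
        (\<forall>u\<in>D. \<forall>e>0. \<exists>v\<in>S. E1 N E (fdiff u v) (fdiff u v) < e))"

definition quasi_regular :: "'b topology \<Rightarrow> 'b measure \<Rightarrow> (('b \<Rightarrow> real) \<Rightarrow> ('b \<Rightarrow> real) \<Rightarrow> real)
    \<Rightarrow> ('b \<Rightarrow> real) set \<Rightarrow> bool" where
  "quasi_regular X N E D \<longleftrightarrow>
     (\<exists>K. nest X N E D K \<and> (\<forall>n. compactin X (K n))) \<and>
     has_dense_qc_subspace X N E D \<and>
     (\<exists>Z (u :: nat \<Rightarrow> 'b \<Rightarrow> real). cap1 X N E D Z = 0 \<and> (\<forall>n. u n \<in> D \<and> quasi_continuous X N E D (u n)) \<and>
        (\<forall>x\<in>topspace X - Z. \<forall>y\<in>topspace X - Z. x \<noteq> y \<longrightarrow> (\<exists>n. u n x \<noteq> u n y)))"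

text \<open>Points of R^n are represented by functions nat => real; only the first n coordinates matter.\<close>

definition pd :: "nat \<Rightarrow> ((nat \<Rightarrow> real) \<Rightarrow> real) \<Rightarrow> (nat \<Rightarrow> real) \<Rightarrow> real" where
  "pd i g x = deriv (\<lambda>t. g (x(i := t))) (x i)"

text \<open>g in C^1_b(R^n): g depends only on the first n coordinates, is bounded, and has
  continuous bounded partial derivatives (product topology on nat => real, which on
  functions of the first n coordinates is the topology of R^n)\<close>
definition C1b :: "nat \<Rightarrow> ((nat \<Rightarrow> real) \<Rightarrow> real) \<Rightarrow> bool" where
  "C1b n g \<longleftrightarrow>
     (\<forall>x y. (\<forall>j<n. x j = y j) \<longrightarrow> g x = g y) \<and> bounded (range g) \<and>
     (\<forall>i<n. (\<forall>x. ((\<lambda>t. g (x(i := t))) has_real_derivative pd i g x) (at (x i))) \<and>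
            continuous_on UNIV (pd i g) \<and> bounded (range (pd i g)))"

definition Cb :: "('a::topological_space \<Rightarrow> real) \<Rightarrow> bool" where
  "Cb f \<longleftrightarrow> continuous_on UNIV f \<and> bounded (range f)"

definition cyl_data :: "nat \<Rightarrow> (nat \<Rightarrow> 'a::topological_space \<Rightarrow> real) \<Rightarrow> ((nat \<Rightarrow> real) \<Rightarrow> real) \<Rightarrow> bool" where
  "cyl_data n f g \<longleftrightarrow> (\<forall>i<n. Cb (f i)) \<and> C1b n g"

definition cyl :: "(nat \<Rightarrow> 'a \<Rightarrow> real) \<Rightarrow> ((nat \<Rightarrow> real) \<Rightarrow> real) \<Rightarrow> 'a measure \<Rightarrow> real" where
  "cyl f g mu = g (\<lambda>i. \<integral>x. f i x \<partial>mu)"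

definition DE :: "nat \<Rightarrow> (nat \<Rightarrow> 'a \<Rightarrow> real) \<Rightarrow> ((nat \<Rightarrow> real) \<Rightarrow> real) \<Rightarrow> 'a measure \<Rightarrow> 'a \<Rightarrow> real" where
  "DE n f g mu x = (\<Sum>i<n. pd i g (\<lambda>j. \<integral>y. f j y \<partial>mu) * f i x)"

definition DE_tilde :: "nat \<Rightarrow> (nat \<Rightarrow> 'a \<Rightarrow> real) \<Rightarrow> ((nat \<Rightarrow> real) \<Rightarrow> real) \<Rightarrow> 'a measure \<Rightarrow> 'a \<Rightarrow> real" where
  "DE_tilde n f g mu x = (\<Sum>i<n. pd i g (\<lambda>j. \<integral>y. f j y \<partial>mu) * (f i x - (\<integral>y. f i y \<partial>mu)))"

definition Linf_norm :: "'a measure \<Rightarrow> ('a \<Rightarrow> real) \<Rightarrow> ennreal" where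
  "Linf_norm mu k = (INF c\<in>{c. AE x in mu. ennreal \<bar>k x\<bar> \<le> c}. c)"

definition L1_norm :: "'a measure \<Rightarrow> ('a \<Rightarrow> real) \<Rightarrow> ennreal" where
  "L1_norm mu k = (\<integral>\<^sup>+ x. ennreal \<bar>k x\<bar> \<partial>mu)"

definition L1_plus_Linf_norm :: "'a measure \<Rightarrow> ('a \<Rightarrow> real) \<Rightarrow> ennreal" where
  "L1_plus_Linf_norm mu h =
     (INF p\<in>{(g, k). g \<in> borel_measurable mu \<and> k \<in> borel_measurable mu \<and> (\<forall>x. h x = g x + k x)}.
        L1_norm mu (fst p) + Linf_norm mu (snd p))"

definition sup_norm :: "'a::topological_space measure set \<Rightarrow> ('a measure \<Rightarrow> real) \<Rightarrow> ennreal" where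
  "sup_norm A u = (SUP mu\<in>A. ennreal \<bar>u mu\<bar>)"

end

theory Submission
  imports Defs
begin

text \<open>The total variation distance to a finite measure \<open>nu\<close> is a countable supremum of
  linear functionals \<open>mu(f j) - nu(f j)\<close> with \<open>f j\<close> continuous and \<open>\<bar>f j\<bar> \<le> 1\<close>. Replacing
  maxima and minima by log-sum-exp, the distance to a finite set of measures is a limit of
  cylinder functions whose extrinsic derivative is a convex combination of the \<open>f j\<close>, so
  that either hypothesis bounds their energy uniformly. Hence the truncated distances
  \<open>arctan (min k\<le>n. rho(mu, nu k))\<close> to the first members of a dense sequence lie in the domain with
  bounded energy and decrease to zero. Convex combinations of them tend to zero in energy norm, and
  their superlevel sets are the complements of finite unions of small balls: off sets of small
  capacity the space is totally bounded, hence relatively compact by completeness.\<close>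

section \<open>Symmetric Dirichlet forms\<close>

text \<open>The hypotheses bound the energy of smooth cylinder functions only, by suprema of the
  derivative, so a minimum of maxima over many indices must cost no more than a single linear
  functional. A soft minimum of soft maxima achieves this: its gradient is a probability vector
  whatever the number of indices. \<open>arctan\<close> makes it bounded, as membership in C^1_b
  requires, and its derivative, with values in (0,1], can only shrink the gradient. On such
  functions both norms of the derivative are at most 2, so either alternative supplies one constant
  \<open>B\<close>. The truncated distances have bounded energy, not small energy, which does not
  yet make a capacity small. Averaging a tail makes the energy small; since the sequence decreases,
  the average still dominates some member of it, hence is bounded below away from finitely many
  balls. The exceptional sets, one for each radius, are added up with geometric weights. The
  statement on probability measures is a transfer: \<open>Pac lam\<close> is closed and of full
  measure, and extension by zero identifies the two forms.\<close>

lemma L2_mult_integrable: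
  assumes "u \<in> L2 N" "v \<in> L2 N"
  shows "integrable N (\<lambda>x. u x * v x)"
proof (rule Bochner_Integration.integrable_bound)
  show "integrable N (\<lambda>x. (u x)\<^sup>2 + (v x)\<^sup>2)"
    using assms by (auto simp: L2_def)
  show "(\<lambda>x. u x * v x) \<in> borel_measurable N"
    using assms by (auto simp: L2_def)
  have "\<bar>a * b\<bar> \<le> a\<^sup>2 + b\<^sup>2" for a b :: real
  proof -
    have "0 \<le> (\<bar>a\<bar> - \<bar>b\<bar>)\<^sup>2" by simp
    then have "2 * (\<bar>a\<bar> * \<bar>b\<bar>) \<le> a\<^sup>2 + b\<^sup>2"
      by (simp add: power2_diff)
    moreover have "0 \<le> \<bar>a\<bar> * \<bar>b\<bar>" by simp
    ultimately show ?thesis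
      unfolding abs_mult by linarith
  qed
  then show "AE x in N. norm (u x * v x) \<le> norm ((u x)\<^sup>2 + (v x)\<^sup>2)"
    by (simp add: sum_power2_ge_zero)
qed

lemma fdiff_eq_add: "fdiff u v = (\<lambda>x. u x + (- 1) * v x)"
  by (auto simp: fdiff_def)

locale dirichlet_form =
  fixes N :: "'b measure" and E :: "('b \<Rightarrow> real) \<Rightarrow> ('b \<Rightarrow> real) \<Rightarrow> real"
    and D :: "('b \<Rightarrow> real) set"
  assumes form: "sym_dirichlet_form N E D"
begin

lemma D_L2: "u \<in> D \<Longrightarrow> u \<in> L2 N"
  using form unfolding sym_dirichlet_form_def by (elim conjE) blast

lemma D_meas: "u \<in> D \<Longrightarrow> u \<in> borel_measurable N"
  using D_L2 by (auto simp: L2_def)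

lemma D_AE: "u \<in> D \<Longrightarrow> v \<in> borel_measurable N \<Longrightarrow> AE x in N. u x = v x \<Longrightarrow> v \<in> D"
  using form unfolding sym_dirichlet_form_def by (elim conjE) blast

lemma D_zero: "(\<lambda>x. 0) \<in> D"
  using form unfolding sym_dirichlet_form_def by (elim conjE)

lemma D_add: "u \<in> D \<Longrightarrow> v \<in> D \<Longrightarrow> (\<lambda>x. u x + v x) \<in> D"
  using form unfolding sym_dirichlet_form_def by (elim conjE) blast

lemma D_scale: "u \<in> D \<Longrightarrow> (\<lambda>x. c * u x) \<in> D"
  using form unfolding sym_dirichlet_form_def by (elim conjE) blast

lemma E_AE: "u \<in> D \<Longrightarrow> u' \<in> D \<Longrightarrow> v \<in> D \<Longrightarrow> AE x in N. u x = u' x \<Longrightarrow> E u v = E u' v"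
  using form unfolding sym_dirichlet_form_def by (elim conjE) blast

lemma E_sym: "u \<in> D \<Longrightarrow> v \<in> D \<Longrightarrow> E u v = E v u"
  using form unfolding sym_dirichlet_form_def by (elim conjE) blast

lemma E_add: "u \<in> D \<Longrightarrow> v \<in> D \<Longrightarrow> w \<in> D \<Longrightarrow> E (\<lambda>x. u x + v x) w = E u w + E v w"
  using form unfolding sym_dirichlet_form_def by (elim conjE) blast

lemma E_scale: "u \<in> D \<Longrightarrow> v \<in> D \<Longrightarrow> E (\<lambda>x. c * u x) v = c * E u v"
  using form unfolding sym_dirichlet_form_def by (elim conjE) blast

lemma E_nonneg: "u \<in> D \<Longrightarrow> 0 \<le> E u u"
  using form unfolding sym_dirichlet_form_def by (elim conjE) blast

lemma D_dense: "f \<in> L2 N \<Longrightarrow> 0 < e \<Longrightarrow> \<exists>u\<in>D. (\<integral>x. (f x - u x)^2 \<partial>N) < e"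
  using form unfolding sym_dirichlet_form_def by (elim conjE) (drule (1) bspec, blast)

lemma D_complete:
  assumes "\<And>n. u n \<in> D"
    and "\<And>e. 0 < e \<Longrightarrow>
      \<exists>M. \<forall>m\<ge>M. \<forall>n\<ge>M. E1 N E (fdiff (u m) (u n)) (fdiff (u m) (u n)) < e"
  shows "\<exists>v\<in>D. (\<lambda>n. E1 N E (fdiff (u n) v) (fdiff (u n) v)) \<longlonglongrightarrow> 0"
proof -
  from form have "\<forall>u. (\<forall>n. u n \<in> D) \<and>
          (\<forall>e>0. \<exists>M. \<forall>m\<ge>M. \<forall>n\<ge>M. E1 N E (fdiff (u m) (u n)) (fdiff (u m) (u n)) < e)
        \<longrightarrow> (\<exists>v\<in>D. (\<lambda>n. E1 N E (fdiff (u n) v) (fdiff (u n) v)) \<longlonglongrightarrow> 0)"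
    unfolding sym_dirichlet_form_def by (elim conjE)
  then show ?thesis
    using assms by (elim allE[of _ u] impE) auto
qed

lemma D_markov:
  assumes "u \<in> D"
  shows "(\<lambda>x. min (max (u x) 0) 1) \<in> D"
    and "E (\<lambda>x. min (max (u x) 0) 1) (\<lambda>x. min (max (u x) 0) 1) \<le> E u u"
  using form assms unfolding sym_dirichlet_form_def by (elim conjE, blast)+

lemma D_fdiff: "u \<in> D \<Longrightarrow> v \<in> D \<Longrightarrow> fdiff u v \<in> D"
  unfolding fdiff_eq_add by (intro D_add D_scale)

section \<open>Quadratic identities and inequalities for \<open>E1\<close>\<close>

lemma E1_sym: "u \<in> D \<Longrightarrow> v \<in> D \<Longrightarrow> E1 N E u v = E1 N E v u"
  by (simp add: E1_def E_sym[of u v] mult.commute)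

lemma E1_add: "u \<in> D \<Longrightarrow> v \<in> D \<Longrightarrow> w \<in> D \<Longrightarrow>
    E1 N E (\<lambda>x. u x + v x) w = E1 N E u w + E1 N E v w"
  by (simp add: E1_def E_add distrib_right L2_mult_integrable D_L2)

lemma E1_scale: "u \<in> D \<Longrightarrow> v \<in> D \<Longrightarrow> E1 N E (\<lambda>x. c * u x) v = c * E1 N E u v"
  by (simp add: E1_def E_scale mult.assoc distrib_left)

lemma E1_nonneg: "u \<in> D \<Longrightarrow> 0 \<le> E1 N E u u"
  by (simp add: E1_def E_nonneg)

lemma integral_le_E1: "u \<in> D \<Longrightarrow> (\<integral>x. (u x)\<^sup>2 \<partial>N) \<le> E1 N E u u"
  by (simp add: E1_def E_nonneg power2_eq_square)

lemma E1_AE: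
  assumes "u \<in> D" "v \<in> D" "AE x in N. u x = v x"
  shows "E1 N E u u = E1 N E v v"
proof -
  have "E u u = E v v"
    using assms by (metis E_AE E_sym)
  moreover have "(\<integral>x. u x * u x \<partial>N) = (\<integral>x. v x * v x \<partial>N)"
    using assms(3) D_meas[OF assms(1)] D_meas[OF assms(2)]
    by (intro integral_cong_AE) auto
  ultimately show ?thesis by (simp add: E1_def)
qed

lemma E1_lin_comb:
  assumes "u \<in> D" "v \<in> D"
  shows "E1 N E (\<lambda>x. a * u x + b * v x) (\<lambda>x. a * u x + b * v x) =
    a\<^sup>2 * E1 N E u u + 2 * a * b * E1 N E u v + b\<^sup>2 * E1 N E v v"
proof -
  have au: "(\<lambda>x. a * u x) \<in> D" and bv: "(\<lambda>x. b * v x) \<in> D"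
    using assms by (auto intro: D_scale)
  let ?w = "\<lambda>x. a * u x + b * v x"
  have w: "?w \<in> D" using au bv by (rule D_add)
  have r: "E1 N E z ?w = a * E1 N E z u + b * E1 N E z v" if "z \<in> D" for z
    using that assms au bv w
    by (simp add: E1_sym[of z] E1_add E1_scale)
  show ?thesis
    using assms au bv w
    by (simp add: E1_add[OF au bv w] E1_scale[OF assms(1) w] E1_scale[OF assms(2) w] r
        E1_sym[of v u] power2_eq_square algebra_simps)
qed

lemma E1_scale_both: "u \<in> D \<Longrightarrow> E1 N E (\<lambda>x. c * u x) (\<lambda>x. c * u x) = c\<^sup>2 * E1 N E u u"
  using E1_lin_comb[of u "\<lambda>x. 0" c 0] D_zero by simp

lemma E1_add_both:
  assumes "u \<in> D" "v \<in> D"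
  shows "E1 N E (\<lambda>x. u x + v x) (\<lambda>x. u x + v x) =
    E1 N E u u + 2 * E1 N E u v + E1 N E v v"
  using E1_lin_comb[OF assms, of 1 1] by simp

lemma E1_fdiff_both:
  assumes "u \<in> D" "v \<in> D"
  shows "E1 N E (fdiff u v) (fdiff u v) = E1 N E u u - 2 * E1 N E u v + E1 N E v v"
  using E1_lin_comb[OF assms, of 1 "- 1"] by (simp add: fdiff_def)

text \<open>The parallelogram identity. When both energies are close to a lower bound for the energy
  of the midpoint, the last term forces \<open>u\<close> and \<open>v\<close> to be close.\<close>

lemma E1_midpoint:
  assumes "u \<in> D" "v \<in> D"
  shows "E1 N E (\<lambda>x. (u x + v x) / 2) (\<lambda>x. (u x + v x) / 2) =
    (E1 N E u u + E1 N E v v) / 2 - E1 N E (fdiff u v) (fdiff u v) / 4"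
  using E1_lin_comb[OF assms, of "1/2" "1/2"] E1_fdiff_both[OF assms]
  by (simp add: power2_eq_square field_simps)

lemma E1_add_le:
  assumes "u \<in> D" "v \<in> D"
  shows "E1 N E (\<lambda>x. u x + v x) (\<lambda>x. u x + v x) \<le> 2 * E1 N E u u + 2 * E1 N E v v"
  using E1_nonneg[OF D_fdiff[OF assms]] E1_fdiff_both[OF assms] E1_add_both[OF assms] by simp

lemma E1_fdiff_commute:
  assumes "u \<in> D" "v \<in> D"
  shows "E1 N E (fdiff u v) (fdiff u v) = E1 N E (fdiff v u) (fdiff v u)"
  using assms E1_sym[OF assms] by (simp add: E1_fdiff_both)

lemma E1_le_fdiff:
  assumes "u \<in> D" "v \<in> D"
  shows "E1 N E v v \<le> 2 * E1 N E (fdiff u v) (fdiff u v) + 2 * E1 N E u u"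
proof -
  have "v = (\<lambda>x. fdiff v u x + u x)" by (auto simp: fdiff_def)
  then have "E1 N E v v \<le> 2 * E1 N E (fdiff v u) (fdiff v u) + 2 * E1 N E u u"
    using E1_add_le[OF D_fdiff[OF assms(2,1)] assms(1)] by simp
  then show ?thesis using E1_fdiff_commute[OF assms] by simp
qed

end

text \<open>Dyadic convex combinations of the tail \<open>u n, u (n+1), ...\<close>. Midpoints are
  what the parallelogram identity handles, and the inductive form gives each property of these
  combinations by a two-case induction.\<close>

inductive_set midpoint_hull :: "(nat \<Rightarrow> 'b \<Rightarrow> real) \<Rightarrow> nat \<Rightarrow> ('b \<Rightarrow> real) set"
  for u :: "nat \<Rightarrow> 'b \<Rightarrow> real" and n :: nat where
  base: "n \<le> k \<Longrightarrow> u k \<in> midpoint_hull u n"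
| mid: "a \<in> midpoint_hull u n \<Longrightarrow> b \<in> midpoint_hull u n \<Longrightarrow> (\<lambda>x. (a x + b x) / 2) \<in> midpoint_hull u n"

lemma midpoint_hull_antimono:
  assumes "m \<le> n" shows "midpoint_hull u n \<subseteq> midpoint_hull u m"
proof
  fix w assume "w \<in> midpoint_hull u n"
  then show "w \<in> midpoint_hull u m"
    by induction (use assms in \<open>auto intro: midpoint_hull.intros\<close>)
qed

lemma midpoint_hull_between:
  assumes "w \<in> midpoint_hull u n" "\<And>k. n \<le> k \<Longrightarrow> c \<le> u k x" "\<And>k. n \<le> k \<Longrightarrow> u k x \<le> d"
  shows "c \<le> w x" "w x \<le> d"
  using assms(1) by (induction) (use assms(2,3) in \<open>auto simp: field_simps\<close>)

text \<open>A combination involves finitely many members, and by monotonicity the one of largest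
  index lies below all of them. This keeps a pointwise lower bound after averaging, which is what
  controls superlevel sets.\<close>

lemma midpoint_hull_ge_member:
  assumes "w \<in> midpoint_hull u n" "\<And>i j x. x \<in> S \<Longrightarrow> i \<le> j \<Longrightarrow> u j x \<le> u i x"
  shows "\<exists>K. \<forall>x\<in>S. u K x \<le> w x"
  using assms(1)
proof induction
  case (base k)
  then show ?case by auto
next
  case (mid a b)
  then obtain K L where KL: "\<forall>x\<in>S. u K x \<le> a x" "\<forall>x\<in>S. u L x \<le> b x" by auto
  have "u (max K L) x \<le> (a x + b x) / 2" if "x \<in> S" for x
  proof -
    have "u (max K L) x \<le> u K x" "u (max K L) x \<le> u L x"
      using assms(2) that by auto
    then show ?thesis using KL that by fastforce
  qed
  then show ?case by blast
qed

text \<open>Pointwise, a combination of the tail from \<open>n\<close> on stays in every interval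
  that contains the values of that tail.\<close>

lemma midpoint_hull_tendsto:
  assumes "\<And>n. w n \<in> midpoint_hull u n" "(\<lambda>n. u n x) \<longlonglongrightarrow> (l::real)"
  shows "(\<lambda>n. w n x) \<longlonglongrightarrow> l"
proof (rule LIMSEQ_I)
  fix r :: real assume r: "0 < r"
  then obtain n0 where n0: "\<And>n. n \<ge> n0 \<Longrightarrow> \<bar>u n x - l\<bar> < r / 2"
    using LIMSEQ_D[OF assms(2), of "r/2"] by auto
  have "norm (w n x - l) < r" if "n \<ge> n0" for n
  proof -
    have "l - r/2 \<le> u k x" "u k x \<le> l + r/2" if "n \<le> k" for k
      using n0[OF order_trans[OF \<open>n \<ge> n0\<close> that]] by linarith+
    from midpoint_hull_between[OF assms(1)[of n] this] show ?thesis
      using r by auto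
  qed
  then show "\<exists>no. \<forall>n\<ge>no. norm (w n x - l) < r" by blast
qed

context dirichlet_form
begin

lemma midpoint_hull_D: "w \<in> midpoint_hull u n \<Longrightarrow> (\<And>n. u n \<in> D) \<Longrightarrow> w \<in> D"
proof (induction rule: midpoint_hull.induct)
  case (mid a b)
  then show ?case
    using D_scale[OF D_add, of a b "1/2"] by simp
qed auto

text \<open>Nearly minimising \<open>E1\<close> over the midpoint hulls of the tails gives, by the
  parallelogram identity, a Cauchy sequence; this replaces weak compactness and the
  Banach--Saks theorem.\<close>

lemma midpoint_hull_E1_Cauchy:
  assumes D: "\<And>n. u n \<in> D" and bd: "\<And>n. E1 N E (u n) (u n) \<le> C"
  obtains w where "\<And>n. w n \<in> midpoint_hull u n"
    and "\<And>n. E1 N E (w n) (w n) \<le> C + 1 / real (Suc n)"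
    and "\<And>e. 0 < e \<Longrightarrow>
      \<exists>M. \<forall>m\<ge>M. \<forall>n\<ge>M. E1 N E (fdiff (w m) (w n)) (fdiff (w m) (w n)) < e"
proof -
  let ?Q = "\<lambda>w. E1 N E w w"
  \<comment> \<open>The hulls shrink with \<open>n\<close>, so these infima increase; they are
    bounded by \<open>C\<close> and hence converge.\<close>
  define c where "c n = Inf (?Q ` midpoint_hull u n)" for n
  have bdd: "bdd_below (?Q ` midpoint_hull u n)" for n
    using E1_nonneg midpoint_hull_D[of _ u n] D by (intro bdd_belowI[of _ 0]) blast
  have ne: "?Q ` midpoint_hull u n \<noteq> {}" for n
    using midpoint_hull.base[of n n u] by auto
  have c_le: "c n \<le> ?Q w" if "w \<in> midpoint_hull u n" for n w
    unfolding c_def using that bdd by (intro cInf_lower) auto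
  have c_C: "c n \<le> C" for n
    using c_le[OF midpoint_hull.base[of n n u]] bd[of n] by simp
  have "incseq c"
    unfolding c_def
    by (intro monoI cInf_superset_mono image_mono midpoint_hull_antimono bdd ne)
  then obtain cl where cl: "c \<longlonglongrightarrow> cl" and c_cl: "\<And>n. c n \<le> cl"
    using incseq_convergent[of c C] c_C by blast
  have "\<exists>w\<in>midpoint_hull u n. ?Q w < c n + 1 / real (Suc n)" for n
    using cInf_lessD[OF ne, of n "c n + 1 / real (Suc n)"] unfolding c_def by auto
  then obtain w where w: "\<And>n. w n \<in> midpoint_hull u n" "\<And>n. ?Q (w n) < c n + 1 / real (Suc n)"
    by metis
  have wD: "w n \<in> D" for n using w(1) D by (rule midpoint_hull_D)
  show ?thesis
  proof
    show "w n \<in> midpoint_hull u n" for n by fact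
    show "?Q (w n) \<le> C + 1 / real (Suc n)" for n
      using w(2)[of n] c_C[of n] by linarith
    fix e :: real assume e: "0 < e"
    have "(\<lambda>n. 4 * (cl + 1 / real (Suc n) - c n)) \<longlonglongrightarrow> 4 * (cl + 0 - cl)"
      by (intro tendsto_intros cl LIMSEQ_Suc[OF lim_1_over_n])
    then have "\<forall>\<^sub>F n in sequentially. 4 * (cl + 1 / real (Suc n) - c n) < e"
      using e by (intro order_tendstoD(2)) auto
    then obtain M where M: "\<And>n. n \<ge> M \<Longrightarrow> 4 * (cl + 1 / real (Suc n) - c n) < e"
      by (auto simp: eventually_sequentially)
    have "?Q (fdiff (w m) (w n)) < e" if "m \<ge> M" "n \<ge> M" for m n
    proof -
      \<comment> \<open>The midpoint competes for the infimum \<open>c M\<close>, whereas both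
        endpoints have energy at most \<open>cl + 1 / real (Suc M)\<close>; four times the gap
        bounds the energy of the difference.\<close>
      have "(\<lambda>x. (w m x + w n x) / 2) \<in> midpoint_hull u M"
        using w(1)[of m] w(1)[of n] midpoint_hull_antimono[OF that(1), of u] midpoint_hull_antimono[OF that(2), of u]
        by (intro midpoint_hull.mid) auto
      from c_le[OF this] have "c M \<le> (?Q (w m) + ?Q (w n)) / 2 - ?Q (fdiff (w m) (w n)) / 4"
        unfolding E1_midpoint[OF wD wD] .
      moreover have "?Q (w k) \<le> cl + 1 / real (Suc M)" if "k \<ge> M" for k
      proof -
        have "1 / real (Suc k) \<le> 1 / real (Suc M)"
          using that by (simp add: frac_le)
        then show ?thesis using w(2)[of k] c_cl[of k] by linarith
      qed
      note this[OF that(1)] this[OF that(2)]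
      ultimately have "?Q (fdiff (w m) (w n)) \<le> 4 * (cl + 1 / real (Suc M) - c M)"
        by argo
      then show ?thesis using M[of M] by simp
    qed
    then show "\<exists>M. \<forall>m\<ge>M. \<forall>n\<ge>M. ?Q (fdiff (w m) (w n)) < e" by blast
  qed
qed

text \<open>The hull sequence converges in \<open>E1\<close> to some \<open>v\<close> in
  \<open>D\<close> and, pointwise and boundedly, to \<open>l\<close>; as \<open>N\<close> is finite,
  dominated convergence identifies \<open>v\<close> with \<open>l\<close> almost everywhere. The
  factor 2 comes from \<open>E1_le_fdiff\<close>. The third conclusion turns pointwise convergence
  into energy convergence of averages.\<close>

lemma bounded_limit_in_D:
  assumes fin: "finite_measure N"
    and D: "\<And>n. u n \<in> D" and bd: "\<And>n. E1 N E (u n) (u n) \<le> C"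
    and B: "\<And>n x. x \<in> space N \<Longrightarrow> \<bar>u n x\<bar> \<le> B"
    and lim: "\<And>x. x \<in> space N \<Longrightarrow> (\<lambda>n. u n x) \<longlonglongrightarrow> l x"
  shows "l \<in> D" and "E1 N E l l \<le> 2 * C"
    and "\<exists>w. (\<forall>n. w n \<in> midpoint_hull u n) \<and> (\<lambda>n. E1 N E (fdiff (w n) l) (fdiff (w n) l)) \<longlonglongrightarrow> 0"
proof -
  interpret finite_measure N by fact
  let ?Q = "\<lambda>w. E1 N E w w"
  obtain w where w: "\<And>n. w n \<in> midpoint_hull u n" "\<And>n. ?Q (w n) \<le> C + 1 / real (Suc n)"
      "\<And>e. 0 < e \<Longrightarrow> \<exists>M. \<forall>m\<ge>M. \<forall>n\<ge>M. ?Q (fdiff (w m) (w n)) < e"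
    using midpoint_hull_E1_Cauchy[of u C] D bd by metis
  have wD: "w n \<in> D" for n using w(1) D by (rule midpoint_hull_D)
  obtain v where v: "v \<in> D" "(\<lambda>n. ?Q (fdiff (w n) v)) \<longlonglongrightarrow> 0"
    using D_complete[OF wD w(3)] by blast
  have [measurable]: "w n \<in> borel_measurable N" "v \<in> borel_measurable N" for n
    using wD v(1) by (auto intro: D_meas)
  have wlim: "(\<lambda>n. w n x) \<longlonglongrightarrow> l x" if "x \<in> space N" for x
    using w(1) lim[OF that] by (rule midpoint_hull_tendsto)
  have wB: "\<bar>w n x\<bar> \<le> B" if "x \<in> space N" for n x
    using midpoint_hull_between[OF w(1), of n "- B" x B] B[OF that] by (simp add: abs_le_iff minus_le_iff)
  have [measurable]: "l \<in> borel_measurable N"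
    by (rule borel_measurable_LIMSEQ_real[OF wlim]) auto
  have lB: "\<bar>l x\<bar> \<le> B" if "x \<in> space N" for x
    using tendsto_rabs[OF wlim[OF that]] wB[OF that] by (intro LIMSEQ_le_const2) auto
  have L2lim: "(\<lambda>n. \<integral>x. (w n x - l x)\<^sup>2 \<partial>N) \<longlonglongrightarrow> (\<integral>x. 0 \<partial>N)"
  proof (rule integral_dominated_convergence)
    show "integrable N (\<lambda>x. (2 * B)\<^sup>2)" by simp
    show "AE x in N. (\<lambda>n. (w n x - l x)\<^sup>2) \<longlonglongrightarrow> 0"
    proof (rule AE_I2)
      fix x assume "x \<in> space N"
      then have "(\<lambda>n. (w n x - l x)\<^sup>2) \<longlonglongrightarrow> (l x - l x)\<^sup>2"
        by (intro tendsto_intros wlim)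
      then show "(\<lambda>n. (w n x - l x)\<^sup>2) \<longlonglongrightarrow> 0" by simp
    qed
    show "AE x in N. norm ((w n x - l x)\<^sup>2) \<le> (2 * B)\<^sup>2" for n
    proof (rule AE_I2)
      fix x assume "x \<in> space N"
      then have "\<bar>w n x - l x\<bar> \<le> \<bar>2 * B\<bar>"
        using wB[of x n] lB[of x] by auto
      then show "norm ((w n x - l x)\<^sup>2) \<le> (2 * B)\<^sup>2"
        by (simp add: abs_le_square_iff)
    qed
  qed auto
  have int_l: "integrable N (\<lambda>x. (w n x - l x)\<^sup>2)" for n
  proof (rule integrable_const_bound[where B="(2 * B)\<^sup>2"])
    show "AE x in N. norm ((w n x - l x)\<^sup>2) \<le> (2 * B)\<^sup>2"
    proof (rule AE_I2)
      fix x assume "x \<in> space N"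
      then have "\<bar>w n x - l x\<bar> \<le> \<bar>2 * B\<bar>"
        using wB[of x n] lB[of x] by auto
      then show "norm ((w n x - l x)\<^sup>2) \<le> (2 * B)\<^sup>2"
        by (simp add: abs_le_square_iff)
    qed
  qed simp
  have int_v: "integrable N (\<lambda>x. (w n x - v x)\<^sup>2)" for n
    using D_L2[OF D_fdiff[OF wD v(1)], of n] by (simp add: L2_def fdiff_def)
  \<comment> \<open>The right side minus the left side is the square of
    \<open>(w n x - l x) + (w n x - v x)\<close>.\<close>
  have le: "(l x - v x)\<^sup>2 \<le> 2 * (w n x - l x)\<^sup>2 + 2 * (w n x - v x)\<^sup>2" for x n
    using zero_le_power2[of "(w n x - l x) + (w n x - v x)"]
    by (simp add: power2_eq_square algebra_simps)
  have int_lv: "integrable N (\<lambda>x. (l x - v x)\<^sup>2)"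
    by (rule Bochner_Integration.integrable_bound[where
          f = "\<lambda>x. 2 * (w 0 x - l x)\<^sup>2 + 2 * (w 0 x - v x)\<^sup>2"])
      (use int_l int_v le in auto)
  have "(\<integral>x. (l x - v x)\<^sup>2 \<partial>N) \<le> 2 * (\<integral>x. (w n x - l x)\<^sup>2 \<partial>N) + 2 * ?Q (fdiff (w n) v)" for n
  proof -
    have "(\<integral>x. (l x - v x)\<^sup>2 \<partial>N) \<le> (\<integral>x. 2 * (w n x - l x)\<^sup>2 + 2 * (w n x - v x)\<^sup>2 \<partial>N)"
      using int_l int_v le by (intro integral_mono int_lv) auto
    also have "\<dots> = 2 * (\<integral>x. (w n x - l x)\<^sup>2 \<partial>N) + 2 * (\<integral>x. (w n x - v x)\<^sup>2 \<partial>N)"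
      using int_l int_v by simp
    finally show ?thesis
      using integral_le_E1[OF D_fdiff[OF wD v(1)], of n] by (simp add: fdiff_def)
  qed
  moreover have "(\<lambda>n. 2 * (\<integral>x. (w n x - l x)\<^sup>2 \<partial>N) + 2 * ?Q (fdiff (w n) v)) \<longlonglongrightarrow> 2 * 0 + 2 * 0"
    using L2lim by (intro tendsto_intros v) simp
  ultimately have "(\<integral>x. (l x - v x)\<^sup>2 \<partial>N) \<le> 0"
    by (intro LIMSEQ_le_const) auto
  then have "(\<integral>x. (l x - v x)\<^sup>2 \<partial>N) = 0"
    by (intro antisym) auto
  then have eq: "AE x in N. v x = l x"
    using integral_nonneg_eq_0_iff_AE[OF int_lv] by auto
  show l: "l \<in> D" by (rule D_AE[OF v(1) _ eq]) simp
  have "?Q (fdiff (w n) v) = ?Q (fdiff (w n) l)" for n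
    using eq by (intro E1_AE D_fdiff wD v l) (auto simp: fdiff_def)
  then have wl: "(\<lambda>n. ?Q (fdiff (w n) l)) \<longlonglongrightarrow> 0" using v(2) by simp
  with w(1) show "\<exists>w. (\<forall>n. w n \<in> midpoint_hull u n) \<and> (\<lambda>n. ?Q (fdiff (w n) l)) \<longlonglongrightarrow> 0" by blast
  have "?Q l \<le> 2 * ?Q (fdiff (w n) l) + 2 * (C + 1 / real (Suc n))" for n
    using order_trans[OF E1_le_fdiff[OF wD l, of n] add_left_mono] w(2)[of n] by simp
  moreover have "(\<lambda>n. 2 * ?Q (fdiff (w n) l) + 2 * (C + 1 / real (Suc n))) \<longlonglongrightarrow> 2 * 0 + 2 * (C + 0)"
    by (intro tendsto_intros wl LIMSEQ_Suc[OF lim_1_over_n])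
  ultimately have "?Q l \<le> 2 * 0 + 2 * (C + 0)"
    by (intro LIMSEQ_le_const) auto
  then show "?Q l \<le> 2 * C" by simp
qed

section \<open>Sums of functions of small energy, and the capacity of countable unions\<close>

lemma D_sum: "(\<And>j. v j \<in> D) \<Longrightarrow> finite I \<Longrightarrow> (\<lambda>x. \<Sum>j\<in>I. v j x) \<in> D"
  by (rotate_tac, induction I rule: finite_induct) (auto intro: D_add D_zero)

text \<open>Peeling off the first summand costs the factor 2 of \<open>E1_add_le\<close>; the ratio
  1/8 absorbs it, since \<open>2 * (1/8)^m + 2 * (4 * (1/8)^(m+1))\<close> is
  \<open>3 * (1/8)^m\<close>.\<close>

lemma E1_sum_geometric:
  assumes "\<And>j. v j \<in> D" "\<And>j. E1 N E (v j) (v j) \<le> (1/8)^j"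
  shows "E1 N E (\<lambda>x. \<Sum>j\<in>{m..<m+l}. v j x) (\<lambda>x. \<Sum>j\<in>{m..<m+l}. v j x) \<le> 4 * (1/8)^m"
proof (induction l arbitrary: m)
  case 0
  then show ?case using E1_scale_both[OF D_zero, of 0] by simp
next
  case (Suc l)
  let ?s = "\<lambda>m l x. \<Sum>j\<in>{m..<m+l}. v j x"
  have sD: "?s m l \<in> D" for m l using assms(1) by (intro D_sum) auto
  have eq: "?s m (Suc l) = (\<lambda>x. v m x + ?s (Suc m) l x)"
    by (auto simp: sum.atLeast_Suc_lessThan)
  have "E1 N E (?s m (Suc l)) (?s m (Suc l)) \<le> 2 * (1/8)^m + 2 * (4 * (1/8)^Suc m)"
    unfolding eq using E1_add_le[OF assms(1)[of m] sD[of "Suc m" l]] assms(2)[of m] Suc[of "Suc m"]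
    by linarith
  also have "\<dots> = 3 * (1/8)^m" by simp
  also have "\<dots> \<le> 4 * (1/8)^m" by (intro mult_right_mono) auto
  finally show ?case .
qed

text \<open>A form of countable subadditivity of capacity: the \<open>E1\<close>-limit of the
  partial sums of the \<open>v j\<close> from \<open>n\<close> on is a competitor for the whole
  union of the \<open>U j\<close>, with energy of order \<open>(1/8)^n\<close>.\<close>

lemma nest_of_small_sets:
  assumes open_U: "\<And>j. openin X (U j)" and sp: "space N = topspace X"
    and D: "\<And>j. v j \<in> D" and bd: "\<And>j. E1 N E (v j) (v j) \<le> (1/8)^j"
    and nn: "\<And>j x. x \<in> space N \<Longrightarrow> 0 \<le> v j x"
    and ge1: "\<And>j x. x \<in> U j \<Longrightarrow> 1 \<le> v j x"
  shows "nest X N E D (\<lambda>n. topspace X - (\<Union>j\<in>{n..}. U j))"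
proof -
  let ?Q = "\<lambda>w. E1 N E w w"
  have cap: "cap1 X N E D (\<Union>j\<in>{n..}. U j) \<le> ennreal (8 * (1/8)^n)" for n
  proof -
    define s where "s l = (\<lambda>x. \<Sum>j\<in>{n..<n+l}. v j x)" for l
    have sD: "s l \<in> D" for l unfolding s_def using D by (intro D_sum) auto
    have diff: "fdiff (s (l + k)) (s l) = (\<lambda>x. \<Sum>j\<in>{n+l..<(n+l)+k}. v j x)" for k l
    proof
      fix x
      show "fdiff (s (l + k)) (s l) x = (\<Sum>j\<in>{n+l..<(n+l)+k}. v j x)"
        using sum.atLeastLessThan_concat[of n "n+l" "n+l+k" "\<lambda>j. v j x"]
        by (simp add: fdiff_def s_def add.assoc)
    qed
    have small: "?Q (fdiff (s m) (s l)) \<le> 4 * (1/8)^(n+l)" if "l \<le> m" for m l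
      using E1_sum_geometric[OF D bd, of "n+l" "m-l"] diff[of l "m-l"] that by simp
    have "\<exists>v\<in>D. (\<lambda>l. ?Q (fdiff (s l) v)) \<longlonglongrightarrow> 0"
    proof (rule D_complete[OF sD])
      fix e :: real assume "0 < e"
      moreover have "(\<lambda>l. 4 * (1/8)^(l+n) :: real) \<longlonglongrightarrow> 4 * 0"
        by (intro tendsto_intros LIMSEQ_ignore_initial_segment LIMSEQ_realpow_zero) auto
      ultimately have "\<forall>\<^sub>F l in sequentially. 4 * (1/8)^(l+n) < e"
        by (intro order_tendstoD(2)) auto
      then obtain M where M: "\<And>l. l \<ge> M \<Longrightarrow> 4 * (1/8)^(l+n) < e"
        by (auto simp: eventually_sequentially)
      have "?Q (fdiff (s m) (s l)) < e" if "m \<ge> M" "l \<ge> M" for m l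
      proof (cases "l \<le> m")
        case True
        then show ?thesis using small[OF True] M[OF that(2)] by (simp add: add.commute)
      next
        case False
        then show ?thesis
          using small[of m l] M[OF that(1)] E1_fdiff_commute[OF sD sD, of m l]
          by (simp add: add.commute)
      qed
      then show "\<exists>M. \<forall>m\<ge>M. \<forall>l\<ge>M. ?Q (fdiff (s m) (s l)) < e" by blast
    qed
    then obtain z where z: "z \<in> D" "(\<lambda>l. ?Q (fdiff (s l) z)) \<longlonglongrightarrow> 0" by blast
    have [measurable]: "s l \<in> borel_measurable N" "z \<in> borel_measurable N" for l
      using sD z(1) by (auto intro: D_meas)
    have "?Q z \<le> 2 * ?Q (fdiff (s l) z) + 2 * (4 * (1/8)^n)" for l
      using E1_le_fdiff[OF sD z(1), of l] E1_sum_geometric[OF D bd, of n l]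
      unfolding s_def by linarith
    moreover have "(\<lambda>l. 2 * ?Q (fdiff (s l) z) + 2 * (4 * (1/8)^n)) \<longlonglongrightarrow> 2 * 0 + 2 * (4 * (1/8)^n)"
      by (intro tendsto_intros z)
    ultimately have "?Q z \<le> 2 * 0 + 2 * (4 * (1/8)^n)"
      by (intro LIMSEQ_le_const) auto
    then have Qz: "?Q z \<le> 8 * (1/8)^n" by simp
    have int2: "integrable N (\<lambda>x. (s p x - z x)\<^sup>2)" for p
      using D_L2[OF D_fdiff[OF sD z(1)], of p] by (simp add: L2_def fdiff_def)
    have "AE x in N. s l x \<le> z x" for l
    proof -
      \<comment> \<open>Nonnegative summands make \<open>s p\<close> increase with \<open>p\<close>,
        so the positive part of \<open>s l - z\<close> is at most the absolute value of
        \<open>s p - z\<close> for every \<open>p \<ge> l\<close>. Its square integral is thus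
        bounded by a null sequence, which yields \<open>s l \<le> z\<close> almost everywhere from
        energy convergence alone.\<close>
      let ?h = "\<lambda>x. (max (s l x - z x) 0)\<^sup>2"
      have h_le: "?h x \<le> (s p x - z x)\<^sup>2" if "l \<le> p" "x \<in> space N" for p x
      proof -
        have "s l x \<le> s p x"
          unfolding s_def using that nn by (intro sum_mono2) auto
        then show ?thesis
          by (intro abs_le_square_iff[THEN iffD1]) auto
      qed
      have int_h: "integrable N ?h"
        by (rule Bochner_Integration.integrable_bound[OF int2[of l]]) (auto simp: h_le)
      have "(\<integral>x. ?h x \<partial>N) \<le> ?Q (fdiff (s p) z)" if "l \<le> p" for p
      proof -
        have "(\<integral>x. ?h x \<partial>N) \<le> (\<integral>x. (s p x - z x)\<^sup>2 \<partial>N)"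
          using h_le[OF that] by (intro integral_mono int_h int2) auto
        also have "\<dots> \<le> ?Q (fdiff (s p) z)"
          using integral_le_E1[OF D_fdiff[OF sD z(1)], of p] by (simp add: fdiff_def)
        finally show ?thesis .
      qed
      then have "(\<integral>x. ?h x \<partial>N) \<le> 0"
        by (intro LIMSEQ_le_const[OF z(2)]) auto
      then have "(\<integral>x. ?h x \<partial>N) = 0" by (intro antisym) auto
      then have "AE x in N. ?h x = 0"
        using integral_nonneg_eq_0_iff_AE[OF int_h] by auto
      then show ?thesis by eventually_elim (auto simp: max_def split: if_splits)
    qed
    then have "AE x in N. \<forall>l. s l x \<le> z x" by (simp add: AE_all_countable)
    then have "AE x in N. x \<in> (\<Union>j\<in>{n..}. U j) \<longrightarrow> 1 \<le> z x"
      using AE_space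
    proof eventually_elim
      case (elim x)
      show ?case
      proof
        assume "x \<in> (\<Union>j\<in>{n..}. U j)"
        then obtain j where j: "n \<le> j" "x \<in> U j" by auto
        have "1 \<le> v j x" using ge1[OF j(2)] .
        \<comment> \<open>Of the partial sums starting at \<open>n\<close>, this is the first that
          contains the term \<open>j\<close>.\<close>
        also have "\<dots> \<le> s (Suc j - n) x"
          unfolding s_def using j nn elim by (intro member_le_sum) auto
        also have "\<dots> \<le> z x" using elim by auto
        finally show "1 \<le> z x" .
      qed
    qed
    then have "cap1_open N E D (\<Union>j\<in>{n..}. U j) \<le> ennreal (?Q z)"
      unfolding cap1_open_def using z(1) by (intro INF_lower) auto
    also have "\<dots> \<le> ennreal (8 * (1/8)^n)" using Qz by (rule ennreal_leI)
    finally show ?thesis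
      unfolding cap1_def using open_U by (intro INF_lower2) auto
  qed
  have sub: "U j \<subseteq> topspace X" for j using open_U openin_subset by blast
  have eq: "topspace X - (topspace X - (\<Union>j\<in>{n..}. U j)) = (\<Union>j\<in>{n..}. U j)" for n
    using sub by blast
  have "(\<lambda>n. 8 * (1/8)^n :: real) \<longlonglongrightarrow> 8 * 0"
    by (intro tendsto_intros LIMSEQ_realpow_zero) auto
  then have lim0: "(\<lambda>n. ennreal (8 * (1/8)^n)) \<longlonglongrightarrow> 0"
    using tendsto_ennrealI by fastforce
  have "(\<lambda>n. cap1 X N E D (\<Union>j\<in>{n..}. U j)) \<longlonglongrightarrow> 0"
    by (rule tendsto_sandwich[OF _ _ tendsto_const lim0]) (auto simp: cap)
  then show ?thesis
    unfolding nest_def eq using open_U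
    by (auto simp: incseq_def intro!: closedin_diff openin_Union)
qed

lemma cap1_empty: "cap1 X N E D {} = 0"
proof -
  have "cap1_open N E D {} \<le> ennreal (E1 N E (\<lambda>x. 0) (\<lambda>x. 0))"
    unfolding cap1_open_def using D_zero by (intro INF_lower) auto
  also have "\<dots> = 0" using E1_scale_both[OF D_zero, of 0] by simp
  finally have "cap1 X N E D {} \<le> 0"
    unfolding cap1_def by (intro INF_lower2[of "{}"]) auto
  then show ?thesis by simp
qed

lemma continuous_imp_quasi_continuous:
  assumes "continuous_map X euclideanreal u"
  shows "quasi_continuous X N E D u"
  unfolding quasi_continuous_def
proof (intro exI conjI allI)
  show "nest X N E D (\<lambda>n. topspace X)"
    by (simp add: nest_def incseq_def cap1_empty)
  show "continuous_map (subtopology X (topspace X)) euclideanreal u"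
    using assms by (simp add: subtopology_topspace)
qed

end

section \<open>Restriction to a closed set of full measure\<close>

text \<open>Functions on \<open>P\<close> are represented by total functions whose values off
  \<open>P\<close> must not count. Extending by zero fixes these values; for
  \<open>P = Pac lam\<close> this is the map \<open>ext\<close> of the theorem.\<close>

definition ext0 :: "'b set \<Rightarrow> ('b \<Rightarrow> real) \<Rightarrow> 'b \<Rightarrow> real" where
  "ext0 P v = (\<lambda>x. if x \<in> P then v x else 0)"

lemma ext0_add: "ext0 P (\<lambda>x. u x + v x) = (\<lambda>x. ext0 P u x + ext0 P v x)"
  and ext0_scale: "ext0 P (\<lambda>x. c * u x) = (\<lambda>x. c * ext0 P u x)"
  and ext0_fdiff: "ext0 P (fdiff u v) = fdiff (ext0 P u) (ext0 P v)"
  and ext0_zero: "ext0 P (\<lambda>x. 0) = (\<lambda>x. 0)"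
  and ext0_clip: "ext0 P (\<lambda>x. min (max (u x) 0) 1) = (\<lambda>x. min (max (ext0 P u x) 0) 1)"
  by (auto simp: ext0_def fdiff_def)

locale dirichlet_form_full_set = dirichlet_form +
  fixes P :: "'a set"
  assumes P_sets: "P \<in> sets N" and P_full: "AE x in N. x \<in> P"
begin

abbreviation "NP \<equiv> restrict_space N P"
abbreviation "DP \<equiv> {v. ext0 P v \<in> D}"
abbreviation "EP \<equiv> (\<lambda>v w. E (ext0 P v) (ext0 P w))"

lemma P_Int: "P \<inter> space N \<in> sets N"
  using P_sets by auto

lemma measurable_ext0: "v \<in> borel_measurable NP \<longleftrightarrow> ext0 P v \<in> borel_measurable N"
proof -
  have "(\<lambda>x. indicator P x *\<^sub>R v x) = ext0 P v"
    by (auto simp: ext0_def indicator_def)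
  then show ?thesis
    by (simp add: borel_measurable_restrict_space_iff[OF P_Int])
qed

lemma AE_ext0: "(AE x in NP. Q x) \<longleftrightarrow> (AE x in N. x \<in> P \<longrightarrow> Q x)"
  by (rule AE_restrict_space_iff[OF P_Int])

lemma integral_ext0:
  fixes f g :: "'a \<Rightarrow> real"
  assumes "\<And>x. x \<in> P \<Longrightarrow> f x = g x" "\<And>x. x \<notin> P \<Longrightarrow> g x = 0"
  shows "integral\<^sup>L NP f = integral\<^sup>L N g" "integrable NP f \<longleftrightarrow> integrable N g"
proof -
  have "(\<lambda>x. indicator P x *\<^sub>R f x) = g"
    using assms by (auto simp: indicator_def)
  then show "integral\<^sup>L NP f = integral\<^sup>L N g" "integrable NP f \<longleftrightarrow> integrable N g"
    by (simp_all add: integral_restrict_space[OF P_Int] integrable_restrict_space[OF P_Int])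
qed

lemma L2_ext0: "v \<in> L2 NP \<longleftrightarrow> ext0 P v \<in> L2 N"
  unfolding L2_def mem_Collect_eq measurable_ext0
  by (subst integral_ext0(2)[of _ "\<lambda>x. (ext0 P v x)\<^sup>2"]) (auto simp: ext0_def)

lemma E1_ext0: "E1 NP EP u v = E1 N E (ext0 P u) (ext0 P v)"
  unfolding E1_def
  by (subst integral_ext0(1)[of _ "\<lambda>x. ext0 P u x * ext0 P v x"]) (auto simp: ext0_def)

lemma ext0_AE: "AE x in N. ext0 P u x = u x"
  using P_full by eventually_elim (auto simp: ext0_def)

lemma ext0_meas: "u \<in> borel_measurable N \<Longrightarrow> ext0 P u \<in> borel_measurable N"
  unfolding ext0_def using P_sets by (intro measurable_If_set) auto

lemma ext0_D: "u \<in> D \<Longrightarrow> ext0 P u \<in> D"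
  by (rule D_AE[of u], assumption, rule ext0_meas[OF D_meas], assumption)
    (use ext0_AE[of u] in \<open>auto elim: eventually_mono\<close>)

lemma E1_ext0_D: "u \<in> D \<Longrightarrow> E1 N E (ext0 P u) (ext0 P u) = E1 N E u u"
  by (intro E1_AE ext0_D ext0_AE)

lemma E1_fdiff_ext0_D:
  assumes "ext0 P u \<in> D" "v \<in> D"
  shows "E1 N E (fdiff (ext0 P u) (ext0 P v)) (fdiff (ext0 P u) (ext0 P v)) =
    E1 N E (fdiff (ext0 P u) v) (fdiff (ext0 P u) v)"
  using ext0_AE[of v]
  by (intro E1_AE D_fdiff assms ext0_D) (auto simp: fdiff_def elim: eventually_mono)

text \<open>\<open>ext0\<close> commutes with the vector operations and, because clipping fixes 0,
  with the unit contraction, so most axioms transfer literally. Density and completeness produce a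
  function of \<open>D\<close> that may fail to vanish off \<open>P\<close>; it equals its zero
  extension almost everywhere.\<close>

lemma sym_dirichlet_form_restrict: "sym_dirichlet_form NP EP DP"
  unfolding sym_dirichlet_form_def mem_Collect_eq ext0_add ext0_scale ext0_zero ext0_clip
    E1_ext0 ext0_fdiff
proof (intro conjI allI impI ballI)
  show "DP \<subseteq> L2 NP" by (auto simp: L2_ext0 D_L2)
  fix u v assume u: "u \<in> DP" and v: "v \<in> borel_measurable NP \<and> (AE x in NP. u x = v x)"
  have "AE x in N. ext0 P u x = ext0 P v x"
    using v unfolding AE_ext0 by (elim conjE eventually_mono) (auto simp: ext0_def)
  then show "ext0 P v \<in> D"
    using D_AE[of "ext0 P u" "ext0 P v"] u v by (auto simp: measurable_ext0)
next
  show "(\<lambda>x. 0) \<in> D" by (rule D_zero)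
next
  fix u v assume "u \<in> DP" "v \<in> DP"
  then show "(\<lambda>x. ext0 P u x + ext0 P v x) \<in> D" by (auto intro: D_add)
next
  fix c u assume "u \<in> DP"
  then show "(\<lambda>x. c * ext0 P u x) \<in> D" by (auto intro: D_scale)
next
  fix u u' v assume "u \<in> DP" "u' \<in> DP" "v \<in> DP" "AE x in NP. u x = u' x"
  then show "E (ext0 P u) (ext0 P v) = E (ext0 P u') (ext0 P v)"
    by (intro E_AE) (auto simp: AE_ext0 ext0_def elim: eventually_mono)
next
  fix u v assume "u \<in> DP" "v \<in> DP"
  then show "E (ext0 P u) (ext0 P v) = E (ext0 P v) (ext0 P u)" by (auto intro: E_sym)
next
  fix u v w assume "u \<in> DP" "v \<in> DP" "w \<in> DP"
  then show "E (\<lambda>x. ext0 P u x + ext0 P v x) (ext0 P w) =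
      E (ext0 P u) (ext0 P w) + E (ext0 P v) (ext0 P w)" by (auto intro: E_add)
next
  fix c u v assume "u \<in> DP" "v \<in> DP"
  then show "E (\<lambda>x. c * ext0 P u x) (ext0 P v) = c * E (ext0 P u) (ext0 P v)"
    by (auto intro: E_scale)
next
  fix u assume "u \<in> DP"
  then show "0 \<le> E (ext0 P u) (ext0 P u)" by (auto intro: E_nonneg)
next
  fix f and e :: real assume f: "f \<in> L2 NP" and e: "0 < e"
  then obtain u where u: "u \<in> D" "(\<integral>x. (ext0 P f x - u x)^2 \<partial>N) < e"
    using D_dense[of "ext0 P f" e] by (auto simp: L2_ext0)
  have [measurable]: "ext0 P f \<in> borel_measurable N" "u \<in> borel_measurable N"
    "ext0 P u \<in> borel_measurable N"
    using f u(1) by (auto simp: L2_def measurable_ext0 intro: D_meas ext0_D)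
  have "(\<integral>x. (f x - u x)^2 \<partial>NP) = (\<integral>x. (ext0 P f x - ext0 P u x)^2 \<partial>N)"
    by (rule integral_ext0(1)) (auto simp: ext0_def)
  also have "\<dots> = (\<integral>x. (ext0 P f x - u x)^2 \<partial>N)"
    using ext0_AE[of u] by (intro integral_cong_AE) (auto elim: eventually_mono)
  finally show "\<exists>u\<in>DP. (\<integral>x. (f x - u x)^2 \<partial>NP) < e"
    using u ext0_D by (intro bexI[of _ u]) auto
next
  fix u :: "nat \<Rightarrow> 'a \<Rightarrow> real"
  assume *: "(\<forall>n. ext0 P (u n) \<in> D) \<and> (\<forall>e>0. \<exists>M. \<forall>m\<ge>M. \<forall>n\<ge>M.
      E1 N E (fdiff (ext0 P (u m)) (ext0 P (u n))) (fdiff (ext0 P (u m)) (ext0 P (u n))) < e)"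
  then obtain v where v: "v \<in> D"
      "(\<lambda>n. E1 N E (fdiff (ext0 P (u n)) v) (fdiff (ext0 P (u n)) v)) \<longlonglongrightarrow> 0"
    using D_complete[of "\<lambda>n. ext0 P (u n)"] by auto
  then show "\<exists>v\<in>DP. (\<lambda>n. E1 N E (fdiff (ext0 P (u n)) (ext0 P v))
      (fdiff (ext0 P (u n)) (ext0 P v))) \<longlonglongrightarrow> 0"
    using * by (intro bexI[of _ v]) (auto simp: E1_fdiff_ext0_D ext0_D)
next
  fix u assume u: "u \<in> DP"
  then have "ext0 P u \<in> D" by simp
  from D_markov[OF this] show "(\<lambda>x. min (max (ext0 P u x) 0) 1) \<in> D"
    "E (\<lambda>x. min (max (ext0 P u x) 0) 1) (\<lambda>x. min (max (ext0 P u x) 0) 1)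
      \<le> E (ext0 P u) (ext0 P u)" .
qed

text \<open>A competitor for the open set \<open>U\<close> also competes for the trace of
  \<open>U\<close> on \<open>P\<close>, and by \<open>E1_ext0_D\<close> its energy is the
  same.\<close>

lemma cap1_restrict_le: "cap1 (subtopology X P) NP EP DP (A \<inter> P) \<le> cap1 X N E D A"
  unfolding cap1_def
proof (rule INF_mono)
  fix U assume U: "U \<in> {U. openin X U \<and> A \<subseteq> U}"
  have "cap1_open NP EP DP (U \<inter> P) \<le> cap1_open N E D U"
    unfolding cap1_open_def
  proof (rule INF_mono)
    fix u assume u: "u \<in> {u \<in> D. AE x in N. x \<in> U \<longrightarrow> 1 \<le> u x}"
    then have "AE x in NP. x \<in> U \<inter> P \<longrightarrow> 1 \<le> u x"
      by (auto simp: AE_ext0 elim: eventually_mono)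
    then show "\<exists>w\<in>{u \<in> DP. AE x in NP. x \<in> U \<inter> P \<longrightarrow> 1 \<le> u x}.
        ennreal (E1 NP EP w w) \<le> ennreal (E1 N E u u)"
      using u by (intro bexI[of _ u]) (auto simp: E1_ext0 E1_ext0_D ext0_D)
  qed
  then show "\<exists>V\<in>{V. openin (subtopology X P) V \<and> A \<inter> P \<subseteq> V}.
      cap1_open NP EP DP V \<le> cap1_open N E D U"
    using U by (intro bexI[of _ "U \<inter> P"]) (auto simp: openin_subtopology)
qed

lemma nest_restrict:
  assumes "nest X N E D K"
  shows "nest (subtopology X P) NP EP DP (\<lambda>n. K n \<inter> P)"
proof -
  have eq: "topspace (subtopology X P) - K n \<inter> P = (topspace X - K n) \<inter> P" for n
    by auto
  have "(\<lambda>n. cap1 (subtopology X P) NP EP DP ((topspace X - K n) \<inter> P)) \<longlonglongrightarrow> 0"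
    by (rule tendsto_sandwich[OF _ _ tendsto_const, of _ _ sequentially
          "\<lambda>n. cap1 X N E D (topspace X - K n)"])
      (use assms in \<open>auto simp: cap1_restrict_le nest_def\<close>)
  then show ?thesis
    unfolding nest_def eq using assms
    by (auto simp: nest_def incseq_def closedin_subtopology)
qed

lemma quasi_continuous_restrict:
  assumes "quasi_continuous X N E D u"
  shows "quasi_continuous (subtopology X P) NP EP DP u"
proof -
  obtain K where K: "nest X N E D K" "\<And>n. continuous_map (subtopology X (K n)) euclideanreal u"
    using assms unfolding quasi_continuous_def by blast
  have "continuous_map (subtopology (subtopology X P) (K n \<inter> P)) euclideanreal u" for n
    using continuous_map_from_subtopology[OF K(2)[of n], of P]
    by (simp add: subtopology_subtopology Int_commute Int_left_commute)
  then show ?thesis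
    unfolding quasi_continuous_def using nest_restrict[OF K(1)] by blast
qed

text \<open>A dense subspace and a separating sequence in \<open>D\<close> serve again as they
  stand, because \<open>ext0_D\<close> puts \<open>D\<close> inside the restricted domain.
  Closedness of \<open>P\<close> keeps the sets \<open>K n \<inter> P\<close> compact.\<close>

lemma quasi_regular_restrict:
  assumes qr: "quasi_regular X N E D" and cl: "closedin X P"
  shows "quasi_regular (subtopology X P) NP EP DP"
  unfolding quasi_regular_def
proof (intro conjI)
  have "\<exists>K. nest X N E D K \<and> (\<forall>n. compactin X (K n))"
    using qr unfolding quasi_regular_def by (elim conjE)
  then obtain K where K: "nest X N E D K" "\<And>n. compactin X (K n)" by blast
  have "compactin (subtopology X P) (K n \<inter> P)" for n
    using closed_Int_compactin[OF cl K(2)[of n]]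
    by (simp add: compactin_subtopology Int_commute)
  with nest_restrict[OF K(1)]
  show "\<exists>K. nest (subtopology X P) NP EP DP K \<and> (\<forall>n. compactin (subtopology X P) (K n))"
    by blast
next
  have "has_dense_qc_subspace X N E D"
    using qr unfolding quasi_regular_def by (elim conjE)
  then obtain S where S: "S \<subseteq> D" "(\<lambda>x. 0) \<in> S"
      "\<forall>u\<in>S. \<forall>v\<in>S. (\<lambda>x. u x + v x) \<in> S" "\<forall>c. \<forall>u\<in>S. (\<lambda>x. c * u x) \<in> S"
      "\<forall>u\<in>S. quasi_continuous X N E D u"
      "\<forall>u\<in>D. \<forall>e>0. \<exists>v\<in>S. E1 N E (fdiff u v) (fdiff u v) < e"
    unfolding has_dense_qc_subspace_def by (elim exE conjE)
  have "\<exists>v\<in>S. E1 NP EP (fdiff u v) (fdiff u v) < e" if u: "u \<in> DP" and e: "0 < e" for u e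
  proof -
    obtain v where v: "v \<in> S" "E1 N E (fdiff (ext0 P u) v) (fdiff (ext0 P u) v) < e"
      using S(6) u e by blast
    then have "E1 NP EP (fdiff u v) (fdiff u v) < e"
      using u S(1) by (subst E1_ext0, unfold ext0_fdiff, subst E1_fdiff_ext0_D) auto
    then show ?thesis using v(1) by blast
  qed
  then show "has_dense_qc_subspace (subtopology X P) NP EP DP"
    unfolding has_dense_qc_subspace_def
  proof (intro exI[of _ S] conjI)
    show "S \<subseteq> DP" using S(1) ext0_D by auto
    show "\<forall>u\<in>S. quasi_continuous (subtopology X P) NP EP DP u"
      using S(5) quasi_continuous_restrict by blast
  qed (use S(2-4) in blast)+
next
  have "\<exists>Z (u :: nat \<Rightarrow> 'a \<Rightarrow> real). cap1 X N E D Z = 0 \<and>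
      (\<forall>n. u n \<in> D \<and> quasi_continuous X N E D (u n)) \<and>
      (\<forall>x\<in>topspace X - Z. \<forall>y\<in>topspace X - Z. x \<noteq> y \<longrightarrow> (\<exists>n. u n x \<noteq> u n y))"
    using qr unfolding quasi_regular_def by (elim conjE)
  then obtain Z and u :: "nat \<Rightarrow> 'a \<Rightarrow> real" where Z: "cap1 X N E D Z = 0"
      "\<forall>n. u n \<in> D \<and> quasi_continuous X N E D (u n)"
      "\<forall>x\<in>topspace X - Z. \<forall>y\<in>topspace X - Z. x \<noteq> y \<longrightarrow> (\<exists>n. u n x \<noteq> u n y)"
    by (elim exE conjE)
  show "\<exists>Z (u :: nat \<Rightarrow> 'a \<Rightarrow> real). cap1 (subtopology X P) NP EP DP Z = 0 \<and>
      (\<forall>n. u n \<in> DP \<and> quasi_continuous (subtopology X P) NP EP DP (u n)) \<and>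
      (\<forall>x\<in>topspace (subtopology X P) - Z. \<forall>y\<in>topspace (subtopology X P) - Z.
        x \<noteq> y \<longrightarrow> (\<exists>n. u n x \<noteq> u n y))"
  proof (intro exI[of _ "Z \<inter> P"] exI[of _ u] conjI allI ballI impI)
    show "cap1 (subtopology X P) NP EP DP (Z \<inter> P) = 0"
      using cap1_restrict_le[of X Z] Z(1) by simp
    show "u n \<in> DP" for n using Z(2) ext0_D by simp
    show "quasi_continuous (subtopology X P) NP EP DP (u n)" for n
      using Z(2) quasi_continuous_restrict by blast
    fix x y assume "x \<in> topspace (subtopology X P) - Z \<inter> P"
      "y \<in> topspace (subtopology X P) - Z \<inter> P" "x \<noteq> y"
    moreover from this have "x \<in> topspace X - Z" "y \<in> topspace X - Z" by auto
    ultimately show "\<exists>n. u n x \<noteq> u n y" using Z(3) by blast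
  qed
qed

end

section \<open>A countable family of test functions\<close>

text \<open>A tent \<open>max 0 (r - dist x a)\<close> is positive exactly on the ball of radius
  \<open>r\<close> around \<open>a\<close>, so the truncated multiple approximates the indicator of
  a finite union of balls. Listing centres and radii makes the family countable over countable
  parameter sets; a radius at most 0 contributes nothing.\<close>

definition bump :: "('a::metric_space \<times> real) list \<Rightarrow> nat \<Rightarrow> 'a \<Rightarrow> real" where
  "bump l n x = min 1 (real n * (\<Sum>p\<leftarrow>l. max 0 (snd p - dist x (fst p))))"

lemma bump_continuous: "continuous_on UNIV (bump l n)"
proof -
  have "continuous_on UNIV (\<lambda>x. \<Sum>p\<leftarrow>l. max 0 (snd p - dist x (fst p)))"
    by (induction l) (auto intro!: continuous_intros)
  then show ?thesis
    unfolding bump_def[abs_def] by (intro continuous_intros)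
qed

lemma bump_bounds: "0 \<le> bump l n x" "bump l n x \<le> 1"
proof -
  have "0 \<le> (\<Sum>p\<leftarrow>l. max 0 (snd p - dist x (fst p)))"
    by (induction l) auto
  then show "0 \<le> bump l n x" "bump l n x \<le> 1"
    by (auto simp: bump_def)
qed

lemma open_indicator_bump_limit:
  fixes U :: "'a::metric_space set"
  assumes S: "\<And>V. open V \<Longrightarrow> V \<noteq> {} \<Longrightarrow> \<exists>a\<in>S. a \<in> V" "countable S" "S \<noteq> {}" and U: "open U"
  obtains l where "\<And>n. l n \<in> lists (S \<times> \<rat>)"
    and "\<And>x. (\<lambda>n. bump (l n) n x) \<longlonglongrightarrow> indicator U x"
proof -
  let ?C = "{p \<in> S \<times> \<rat>. ball (fst p) (snd p) \<subseteq> U}"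
  have cC: "countable ?C"
    using S(2) countable_rat by (intro countable_Collect countable_SIGMA) auto
  obtain a0 where "a0 \<in> S" using S(3) by blast
  \<comment> \<open>The ball of radius 0 is empty, so the index set is nonempty even if
    \<open>U\<close> is empty, as \<open>from_nat_into\<close> requires.\<close>
  then have neC: "?C \<noteq> {}" by (auto intro!: exI[of _ a0] exI[of _ "0::real"])
  let ?q = "from_nat_into ?C"
  have q: "?q i \<in> ?C" for i using neC by (rule from_nat_into)
  define l where "l n = map ?q [0..<n]" for n
  show ?thesis
  proof
    show "l n \<in> lists (S \<times> \<rat>)" for n
      unfolding l_def in_lists_conv_set set_map using q by blast
    fix x
    have sum_eq: "(\<Sum>p\<leftarrow>l n. max 0 (snd p - dist x (fst p))) =
        (\<Sum>i<n. max 0 (snd (?q i) - dist x (fst (?q i))))" for n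
      by (simp add: l_def interv_sum_list_conv_sum_set_nat o_def atLeast0LessThan)
    show "(\<lambda>n. bump (l n) n x) \<longlonglongrightarrow> indicator U x"
    proof (cases "x \<in> U")
      case False
      have "max 0 (snd (?q i) - dist x (fst (?q i))) = 0" for i
      proof -
        have "x \<notin> ball (fst (?q i)) (snd (?q i))" using q[of i] False by auto
        then show ?thesis by (simp add: dist_commute)
      qed
      then have "bump (l n) n x = 0" for n unfolding bump_def sum_eq by simp
      then show ?thesis using False by simp
    next
      case True
      then obtain e where e: "0 < e" "ball x e \<subseteq> U" using U openE by blast
      obtain a where a: "a \<in> S" "a \<in> ball x (e / 3)"
        using S(1)[of "ball x (e/3)"] e by auto
      \<comment> \<open>As \<open>dist x a < e/3\<close>, the bound \<open>e/3 < r\<close> puts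
        \<open>x\<close> into the ball around \<open>a\<close>, and \<open>r < e/2\<close> keeps
        that ball within distance \<open>e\<close> of \<open>x\<close>, hence in
        \<open>U\<close>.\<close>
      obtain r where r: "r \<in> \<rat>" "e / 3 < r" "r < e / 2"
        using Rats_dense_in_real[of "e/3" "e/2"] e by auto
      have "ball a r \<subseteq> U"
      proof
        fix y assume "y \<in> ball a r"
        then have "dist x y < e"
          using dist_triangle[of x y a] a(2) r e by (auto simp: dist_commute)
        then show "y \<in> U" using e by auto
      qed
      then have "(a, r) \<in> ?C" using a r by auto
      then obtain i where i: "?q i = (a, r)"
        using from_nat_into_surj[OF cC] by blast
      define d where "d = r - dist x a"
      have d: "0 < d" using a(2) r by (auto simp: d_def)
      obtain n0 where n0: "1 / d < real n0" using reals_Archimedean2 by blast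
      \<comment> \<open>\<open>Suc i\<close> ensures that the \<open>i\<close>-th ball is among the
        first \<open>n\<close>, and \<open>n0\<close> that \<open>n\<close> times its tent height
        \<open>d\<close> reaches the cutoff 1.\<close>
      have "bump (l n) n x = 1" if n: "n \<ge> max (Suc i) n0" for n
      proof -
        have "d \<le> (\<Sum>i<n. max 0 (snd (?q i) - dist x (fst (?q i))))"
          using member_le_sum[of i "{..<n}" "\<lambda>i. max 0 (snd (?q i) - dist x (fst (?q i)))"] n i
          by (auto simp: d_def)
        moreover have "1 \<le> real n * d"
        proof -
          have "1 / d \<le> real n" using n0 n by auto
          then show ?thesis using d by (simp add: divide_le_eq)
        qed
        ultimately have "1 \<le> real n * (\<Sum>i<n. max 0 (snd (?q i) - dist x (fst (?q i))))"
          by (meson mult_left_mono of_nat_0_le_iff order_trans)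
        then show ?thesis unfolding bump_def sum_eq by simp
      qed
      then have "eventually (\<lambda>n. bump (l n) n x = indicator U x) sequentially"
        using True unfolding eventually_sequentially
        by (intro exI[of _ "max (Suc i) n0"]) (simp add: indicator_def)
      then show ?thesis by (rule tendsto_eventually)
    qed
  qed
qed

text \<open>The family is chosen before the measure. This uniformity matters when the density of
  \<open>K\<close> is the absolute difference of two densities and so varies with the pair of
  measures. For a given \<open>K\<close>, outer regularity passes from \<open>A\<close> to an open
  set, whose indicator is a limit of bumps.\<close>

lemma countable_bump_family:
  obtains b :: "nat \<Rightarrow> 'a::polish_space \<Rightarrow> real"
  where "\<And>i. continuous_on UNIV (b i)" "\<And>i x. 0 \<le> b i x" "\<And>i x. b i x \<le> 1"
    and "\<And>(K :: 'a measure) A e. finite_measure K \<Longrightarrow> sets K = sets borel \<Longrightarrow> A \<in> sets borel \<Longrightarrow> 0 < e \<Longrightarrow>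
      \<exists>i. (\<integral>x. \<bar>indicator A x - b i x\<bar> \<partial>K) < e"
proof -
  obtain S :: "'a set" where S: "countable S" "\<And>V. open V \<Longrightarrow> V \<noteq> {} \<Longrightarrow> \<exists>a\<in>S. a \<in> V"
    using countable_dense_setE by blast
  have neS: "S \<noteq> {}" using S(2)[of UNIV] by auto
  let ?I = "lists (S \<times> \<rat>) \<times> (UNIV :: nat set)"
  have cI: "countable ?I"
    using S(1) countable_rat by (intro countable_SIGMA countable_lists) auto
  have neI: "?I \<noteq> {}" by auto
  define b where "b i = (case from_nat_into ?I i of (l, n) \<Rightarrow> bump l n)" for i
  have b: "\<exists>i. b i = bump l n" if "l \<in> lists (S \<times> \<rat>)" for l n
  proof -
    have "(l, n) \<in> ?I" using that by blast
    then obtain i where "from_nat_into ?I i = (l, n)"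
      using from_nat_into_surj[OF cI] by blast
    then show ?thesis by (intro exI[of _ i]) (simp add: b_def)
  qed
  have b_bump: "\<exists>l n. b i = bump l n" for i
    by (auto simp: b_def split: prod.splits)
  show ?thesis
  proof
    fix i
    obtain l n where ln: "b i = bump l n" using b_bump by blast
    show "continuous_on UNIV (b i)" "0 \<le> b i x" "b i x \<le> 1" for x
      unfolding ln using bump_continuous bump_bounds by auto
  next
    fix K :: "'a measure" and A :: "'a set" and e :: real
    assume K: "finite_measure K" and sets_K: "sets K = sets borel"
      and A: "A \<in> sets borel" and e: "0 < e"
    interpret finite_measure K by fact
    note sets_K[measurable_cong]
    have "emeasure K A = (INF U\<in>{U. A \<subseteq> U \<and> open U}. emeasure K U)"
      using outer_regular[of K A] sets_K A emeasure_finite by auto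
    then have "(INF U\<in>{U. A \<subseteq> U \<and> open U}. emeasure K U) < emeasure K A + ennreal (e/2)"
      using e emeasure_finite[of A] by (simp add: ennreal_zero_less_divide less_top)
    then obtain U where U: "A \<subseteq> U" "open U" "emeasure K U < emeasure K A + ennreal (e/2)"
      by (auto simp: INF_less_iff)
    have mU: "U \<in> sets K" "A \<in> sets K" using U A sets_K by auto
    have "ennreal (measure K U) < ennreal (measure K A + e / 2)"
      using U(3) e by (simp add: emeasure_eq_measure)
    then have "measure K U < measure K A + e / 2"
      by (simp add: ennreal_less_iff)
    then have AU: "(\<integral>x. \<bar>indicator A x - indicator U x\<bar> \<partial>K) < e / 2"
    proof -
      have eq: "\<bar>indicator A x - indicator U x\<bar> = (indicator (U - A) x :: real)" for x
        using U(1) by (auto simp: indicator_def)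
      have "(\<integral>x. \<bar>indicator A x - indicator U x\<bar> \<partial>K) = measure K (U - A)"
        unfolding eq using mU sets_eq_imp_space_eq[OF sets_K] by simp
      also have "\<dots> = measure K U - measure K A"
        using mU U(1) by (rule finite_measure_Diff)
      finally show ?thesis using \<open>measure K U < _\<close> by simp
    qed
    obtain l where l: "\<And>n. l n \<in> lists (S \<times> \<rat>)"
        "\<And>x. (\<lambda>n. bump (l n) n x) \<longlonglongrightarrow> indicator U x"
      using open_indicator_bump_limit[OF S(2) S(1) neS U(2)] by blast
    have [measurable]: "bump k n \<in> borel_measurable K" for k :: "('a \<times> real) list" and n
      using borel_measurable_continuous_onI[OF bump_continuous] sets_K
      by (simp cong: measurable_cong_sets)
    have bd: "\<bar>indicator U x - bump k n x\<bar> \<le> 1" for x and k n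
      using bump_bounds[of k n x] by (auto simp: indicator_def)
    have "(\<lambda>n. \<integral>x. \<bar>indicator U x - bump (l n) n x\<bar> \<partial>K) \<longlonglongrightarrow> (\<integral>x. 0 \<partial>K)"
    proof (rule integral_dominated_convergence[where w="\<lambda>x. 1"])
      show "AE x in K. (\<lambda>n. \<bar>indicator U x - bump (l n) n x\<bar>) \<longlonglongrightarrow> 0"
      proof (rule AE_I2)
        fix x
        have "(\<lambda>n. \<bar>indicator U x - bump (l n) n x\<bar>) \<longlonglongrightarrow> \<bar>indicator U x - indicator U x\<bar>"
          by (intro tendsto_intros l)
        then show "(\<lambda>n. \<bar>indicator U x - bump (l n) n x\<bar>) \<longlonglongrightarrow> 0" by simp
      qed
    qed (use mU bd in auto)
    then have "eventually (\<lambda>n. (\<integral>x. \<bar>indicator U x - bump (l n) n x\<bar> \<partial>K) < e / 2) sequentially"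
      using e by (intro order_tendstoD(2)) auto
    then obtain n where n: "(\<integral>x. \<bar>indicator U x - bump (l n) n x\<bar> \<partial>K) < e / 2"
      by (auto simp: eventually_sequentially)
    obtain i where i: "b i = bump (l n) n" using b[OF l(1)] by blast
    have int1: "integrable K (\<lambda>x. \<bar>indicator A x - indicator U x :: real\<bar>)"
      using mU by (intro integrable_const_bound[of _ 1]) (auto simp: indicator_def)
    have int2: "integrable K (\<lambda>x. \<bar>indicator U x - bump (l n) n x\<bar>)"
      using mU bd by (intro integrable_const_bound[of _ 1]) auto
    have "(\<integral>x. \<bar>indicator A x - b i x\<bar> \<partial>K) \<le>
        (\<integral>x. \<bar>indicator A x - indicator U x\<bar> + \<bar>indicator U x - bump (l n) n x\<bar> \<partial>K)"
      unfolding i using int1 int2 mU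
      by (intro integral_mono' Bochner_Integration.integrable_add) auto
    also have "\<dots> = (\<integral>x. \<bar>indicator A x - indicator U x\<bar> \<partial>K) +
        (\<integral>x. \<bar>indicator U x - bump (l n) n x\<bar> \<partial>K)"
      using int1 int2 by simp
    finally show "\<exists>i. (\<integral>x. \<bar>indicator A x - b i x\<bar> \<partial>K) < e"
      using AU n by (intro exI[of _ i]) linarith
  qed
qed

section \<open>The total variation metric\<close>

text \<open>Indicators are approximable by assumption, and \<open>integrable_induct\<close> carries
  this over to sums and dominated limits. Coefficients are rational and the combination is a list,
  so that the approximants can be enumerated.\<close>

lemma L1_dense_family:
  fixes b :: "nat \<Rightarrow> 'a \<Rightarrow> real" and phi :: "'a \<Rightarrow> real"
  assumes fin: "finite_measure K"
    and meas: "\<And>i. b i \<in> borel_measurable K" and bd: "\<And>i x. \<bar>b i x\<bar> \<le> 1"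
    and approx: "\<And>A e. A \<in> sets K \<Longrightarrow> 0 < e \<Longrightarrow> \<exists>i. (\<integral>x. \<bar>indicator A x - b i x\<bar> \<partial>K) < e"
    and phi: "integrable K phi" and e: "0 < e"
  shows "\<exists>l :: (nat \<times> rat) list. (\<integral>x. \<bar>phi x - (\<Sum>p\<leftarrow>l. of_rat (snd p) * b (fst p) x)\<bar> \<partial>K) < e"
proof -
  interpret finite_measure K by fact
  let ?G = "\<lambda>l x. (\<Sum>p\<leftarrow>l. of_rat (snd p) * b (fst p) x)"
  have int_b: "integrable K (b i)" for i
    using meas bd by (intro integrable_const_bound[of _ 1]) auto
  have int_G: "integrable K (?G l)" for l :: "(nat \<times> rat) list"
    by (induction l) (auto intro!: int_b)
  show ?thesis
    using phi e
  proof (induction arbitrary: e rule: integrable_induct)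
    case (base A c)
    define m where "m = measure K (space K)"
    have m: "0 \<le> m" by (simp add: m_def)
    \<comment> \<open>The tolerances leave \<open>e/2\<close> for the indicator error scaled by
      \<open>c\<close> and \<open>e/2\<close> for rounding \<open>c\<close> over the total mass
      \<open>m\<close>; adding 1 keeps the denominators positive when \<open>c\<close> or
      \<open>m\<close> is 0.\<close>
    obtain i where i: "(\<integral>x. \<bar>indicator A x - b i x\<bar> \<partial>K) < e / (2 * (\<bar>c\<bar> + 1))"
      using approx[OF base(1), of "e / (2 * (\<bar>c\<bar> + 1))"] base(3) by auto
    obtain q :: rat where q: "\<bar>c - of_rat q\<bar> < e / (2 * (m + 1))"
    proof -
      have "c < c + e / (2 * (m + 1))" using base(3) m by simp
      then obtain q where "c < of_rat q" "of_rat q < c + e / (2 * (m + 1))"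
        using of_rat_dense by blast
      then show thesis by (intro that[of q]) auto
    qed
    have int1: "integrable K (\<lambda>x. \<bar>indicator A x - b i x\<bar>)"
      using base(1,2)
      by (intro integrable_abs Bochner_Integration.integrable_diff int_b integrable_real_indicator)
    have "(\<integral>x. \<bar>indicator A x *\<^sub>R c - of_rat q * b i x\<bar> \<partial>K) \<le>
        (\<integral>x. \<bar>c\<bar> * \<bar>indicator A x - b i x\<bar> + \<bar>c - of_rat q\<bar> \<partial>K)"
    proof (rule integral_mono')
      show "integrable K (\<lambda>x. \<bar>c\<bar> * \<bar>indicator A x - b i x\<bar> + \<bar>c - of_rat q\<bar>)"
        using int1 by auto
      fix x
      have "indicator A x *\<^sub>R c - of_rat q * b i x =
          c * (indicator A x - b i x) + (c - of_rat q) * b i x"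
        by (simp add: algebra_simps)
      also have "\<bar>\<dots>\<bar> \<le> \<bar>c * (indicator A x - b i x)\<bar> + \<bar>(c - of_rat q) * b i x\<bar>"
        by (rule abs_triangle_ineq)
      also have "\<dots> \<le> \<bar>c\<bar> * \<bar>indicator A x - b i x\<bar> + \<bar>c - of_rat q\<bar>"
        using bd[of i x] by (simp add: abs_mult mult_left_le)
      finally show "\<bar>indicator A x *\<^sub>R c - of_rat q * b i x\<bar> \<le>
          \<bar>c\<bar> * \<bar>indicator A x - b i x\<bar> + \<bar>c - of_rat q\<bar>" .
    qed auto
    also have "\<dots> = \<bar>c\<bar> * (\<integral>x. \<bar>indicator A x - b i x\<bar> \<partial>K) + m * \<bar>c - of_rat q\<bar>"
      using int1 by (simp add: m_def)
    also have "\<dots> < e / 2 + e / 2"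
    proof (rule add_le_less_mono)
      have "\<bar>c\<bar> * (\<integral>x. \<bar>indicator A x - b i x\<bar> \<partial>K) \<le> (\<bar>c\<bar> + 1) * (e / (2 * (\<bar>c\<bar> + 1)))"
        using i by (intro mult_mono) auto
      also have "\<dots> = e / 2" by (simp add: field_simps)
      finally show "\<bar>c\<bar> * (\<integral>x. \<bar>indicator A x - b i x\<bar> \<partial>K) \<le> e / 2" .
      have "m * \<bar>c - of_rat q\<bar> \<le> m * (e / (2 * (m + 1)))"
        using q m by (intro mult_left_mono) auto
      also have "\<dots> < (m + 1) * (e / (2 * (m + 1)))"
        using base(3) m by (intro mult_strict_right_mono) auto
      also have "\<dots> = e / 2" using m by (simp add: field_simps)
      finally show "m * \<bar>c - of_rat q\<bar> < e / 2" .
    qed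
    finally show ?case by (intro exI[of _ "[(i, q)]"]) simp
  next
    case (add f g)
    from add(3,4)[of "e/2"] add(5) obtain l k :: "(nat \<times> rat) list" where
      lk: "(\<integral>x. \<bar>f x - ?G l x\<bar> \<partial>K) < e/2" "(\<integral>x. \<bar>g x - ?G k x\<bar> \<partial>K) < e/2"
      by auto
    have "(\<integral>x. \<bar>(f x + g x) - ?G (l @ k) x\<bar> \<partial>K) \<le> (\<integral>x. \<bar>f x - ?G l x\<bar> + \<bar>g x - ?G k x\<bar> \<partial>K)"
      using add(1,2) int_G by (intro integral_mono') auto
    also have "\<dots> = (\<integral>x. \<bar>f x - ?G l x\<bar> \<partial>K) + (\<integral>x. \<bar>g x - ?G k x\<bar> \<partial>K)"
      using add(1,2) int_G by simp
    finally show ?case using lk by (intro exI[of _ "l @ k"]) linarith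
  next
    case (lim f s)
    note [measurable] = borel_measurable_integrable[OF lim(1)] borel_measurable_integrable[OF lim(4)]
    have "(\<lambda>i. \<integral>x. \<bar>f x - s i x\<bar> \<partial>K) \<longlonglongrightarrow> (\<integral>x. 0 \<partial>K)"
    proof (rule integral_dominated_convergence)
      \<comment> \<open>The approximants satisfy \<open>norm (s i x) \<le> 2 * norm (f x)\<close>,
        so three times the norm of \<open>f\<close> dominates the difference.\<close>
      show "integrable K (\<lambda>x. 3 * norm (f x))" using lim(4) by auto
      show "AE x in K. (\<lambda>i. \<bar>f x - s i x\<bar>) \<longlonglongrightarrow> 0"
      proof (rule AE_I2)
        fix x assume "x \<in> space K"
        then have "(\<lambda>i. \<bar>f x - s i x\<bar>) \<longlonglongrightarrow> \<bar>f x - f x\<bar>" by (intro tendsto_intros lim(2))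
        then show "(\<lambda>i. \<bar>f x - s i x\<bar>) \<longlonglongrightarrow> 0" by simp
      qed
      show "AE x in K. norm \<bar>f x - s i x\<bar> \<le> 3 * norm (f x)" for i
      proof (rule AE_I2)
        fix x assume "x \<in> space K"
        from lim(3)[OF this, of i] show "norm \<bar>f x - s i x\<bar> \<le> 3 * norm (f x)" by auto
      qed
    qed auto
    then have "eventually (\<lambda>i. (\<integral>x. \<bar>f x - s i x\<bar> \<partial>K) < e/2) sequentially"
      using lim(6) by (intro order_tendstoD(2)) auto
    then obtain i where i: "(\<integral>x. \<bar>f x - s i x\<bar> \<partial>K) < e/2"
      by (auto simp: eventually_sequentially)
    obtain l :: "(nat \<times> rat) list" where l: "(\<integral>x. \<bar>s i x - ?G l x\<bar> \<partial>K) < e/2"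
      using lim(5)[of "e/2" i] lim(6) by auto
    have "(\<integral>x. \<bar>f x - ?G l x\<bar> \<partial>K) \<le> (\<integral>x. \<bar>f x - s i x\<bar> + \<bar>s i x - ?G l x\<bar> \<partial>K)"
      using lim(1,4) int_G by (intro integral_mono') auto
    also have "\<dots> = (\<integral>x. \<bar>f x - s i x\<bar> \<partial>K) + (\<integral>x. \<bar>s i x - ?G l x\<bar> \<partial>K)"
      using lim(1,4) int_G by simp
    finally show ?case using i l by (intro exI[of _ l]) linarith
  qed
qed

lemma AE_summable_of_summable_L1:
  fixes f :: "nat \<Rightarrow> 'a \<Rightarrow> real"
  assumes "\<And>k. integrable M (f k)" "summable (\<lambda>k. \<integral>x. \<bar>f k x\<bar> \<partial>M)"
  shows "AE x in M. summable (\<lambda>k. \<bar>f k x\<bar>)"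
proof -
  have [measurable]: "f k \<in> borel_measurable M" for k using assms(1) by auto
  have "(\<integral>\<^sup>+x. (\<Sum>k. ennreal \<bar>f k x\<bar>) \<partial>M) = (\<Sum>k. \<integral>\<^sup>+x. ennreal \<bar>f k x\<bar> \<partial>M)"
    by (rule nn_integral_suminf) auto
  also have "\<dots> = (\<Sum>k. ennreal (\<integral>x. \<bar>f k x\<bar> \<partial>M))"
    using assms(1) by (intro suminf_cong nn_integral_eq_integral) auto
  also have "\<dots> = ennreal (\<Sum>k. \<integral>x. \<bar>f k x\<bar> \<partial>M)"
    using assms(2) by (intro suminf_ennreal2) auto
  finally have "(\<integral>\<^sup>+x. (\<Sum>k. ennreal \<bar>f k x\<bar>) \<partial>M) \<noteq> \<infinity>" by simp
  then have "AE x in M. (\<Sum>k. ennreal \<bar>f k x\<bar>) \<noteq> \<infinity>"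
    by (intro nn_integral_PInf_AE) auto
  then show ?thesis
    by eventually_elim (auto intro!: summable_suminf_not_top)
qed

section \<open>The finite measures with a density, as a complete separable metric space\<close>

locale reference_measure = sigma_finite_measure lam
  for lam :: "'a::polish_space measure" +
  assumes lam_borel: "sets lam = sets borel"
begin

lemma space_lam [simp]: "space lam = UNIV"
  using sets_eq_imp_space_eq[OF lam_borel] by simp

lemma UNIV_sets_lam [simp]: "UNIV \<in> sets lam"
  using sets.top[of lam] by simp

lemma borel_measurable_lam: "borel_measurable lam = borel_measurable borel"
  using lam_borel by (rule measurable_cong_sets) simp

lemma Mac_finite: "mu \<in> Mac lam \<Longrightarrow> finite_measure mu"
  and Mac_sets: "mu \<in> Mac lam \<Longrightarrow> sets mu = sets borel"
  and Mac_ac: "mu \<in> Mac lam \<Longrightarrow> absolutely_continuous lam mu"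
  by (auto simp: Mac_def fin_meas_def)

lemma dens_nonneg: "0 \<le> dens lam mu x"
  by (simp add: dens_def)

lemma dens_measurable [measurable]: "dens lam mu \<in> borel_measurable lam"
  unfolding dens_def[abs_def] by measurable

text \<open>The Radon-Nikodym derivative of a finite measure is finite almost everywhere, so passing
  to reals by \<open>enn2real\<close> changes it on a null set only.\<close>

lemma density_dens:
  assumes "mu \<in> Mac lam"
  shows "density lam (\<lambda>x. ennreal (dens lam mu x)) = mu"
proof -
  interpret mu: finite_measure mu using assms by (rule Mac_finite)
  have s: "sets mu = sets lam" using Mac_sets[OF assms] lam_borel by simp
  have "AE x in lam. RN_deriv lam mu x \<noteq> \<infinity>"
    using RN_deriv_finite[OF mu.sigma_finite_measure_axioms Mac_ac[OF assms] s] .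
  then have "density lam (\<lambda>x. ennreal (dens lam mu x)) = density lam (RN_deriv lam mu)"
    by (intro density_cong) (auto simp: dens_def less_top elim!: eventually_mono)
  also have "\<dots> = mu" using density_RN_deriv[OF Mac_ac[OF assms] s] .
  finally show ?thesis .
qed

lemma dens_integrable:
  assumes "mu \<in> Mac lam"
  shows "integrable lam (dens lam mu)"
proof -
  interpret mu: finite_measure mu using assms by (rule Mac_finite)
  have "(\<integral>\<^sup>+x. ennreal (dens lam mu x) \<partial>lam) = emeasure (density lam (\<lambda>x. ennreal (dens lam mu x))) (space lam)"
    by (subst emeasure_density) (auto intro!: nn_integral_cong)
  also have "\<dots> = emeasure mu UNIV" using density_dens[OF assms] by simp
  also have "\<dots> < \<infinity>" using mu.emeasure_finite by (simp add: less_top[symmetric])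
  finally show ?thesis
    by (intro integrableI_nonneg) (auto simp: dens_nonneg)
qed

lemma integral_Mac:
  fixes f :: "'a \<Rightarrow> real"
  assumes "mu \<in> Mac lam" "f \<in> borel_measurable borel"
  shows "(\<integral>x. f x \<partial>mu) = (\<integral>x. dens lam mu x * f x \<partial>lam)"
proof -
  have "f \<in> borel_measurable lam" using assms(2) by (simp add: borel_measurable_lam)
  from integral_density[OF this dens_measurable, of mu] show ?thesis
    by (simp add: density_dens[OF assms(1)] dens_nonneg)
qed

lemma density_in_Mac:
  assumes g: "integrable lam g" "\<And>x. 0 \<le> g x"
  shows "density lam (\<lambda>x. ennreal (g x)) \<in> Mac lam"
    and "AE x in lam. dens lam (density lam (\<lambda>x. ennreal (g x))) x = g x"
proof -
  let ?mu = "density lam (\<lambda>x. ennreal (g x))"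
  have [measurable]: "g \<in> borel_measurable lam" using g by auto
  have "emeasure ?mu (space ?mu) = (\<integral>\<^sup>+x. ennreal (g x) \<partial>lam)"
    by (subst emeasure_density) (auto intro!: nn_integral_cong)
  also have "\<dots> = ennreal (\<integral>x. g x \<partial>lam)"
    using g by (intro nn_integral_eq_integral) auto
  finally have "finite_measure ?mu" by (intro finite_measureI) simp
  then show "?mu \<in> Mac lam"
    by (auto simp: Mac_def fin_meas_def lam_borel absolutely_continuousI_density)
  have "AE x in lam. ennreal (g x) = RN_deriv lam ?mu x"
    by (rule RN_deriv_unique) auto
  then show "AE x in lam. dens lam ?mu x = g x"
    by eventually_elim (metis dens_def enn2real_ennreal g(2))
qed

lemma rho_var_density:
  assumes "integrable lam g" "\<And>x. 0 \<le> g x"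
  shows "rho_var lam mu (density lam (\<lambda>x. ennreal (g x))) = (\<integral>x. \<bar>dens lam mu x - g x\<bar> \<partial>lam)"
  unfolding rho_var_def using density_in_Mac(2)[of g] assms
  by (intro integral_cong_AE) (auto elim!: eventually_mono)

lemma rho_var_integrable:
  "mu \<in> Mac lam \<Longrightarrow> nu \<in> Mac lam \<Longrightarrow> integrable lam (\<lambda>x. \<bar>dens lam mu x - dens lam nu x\<bar>)"
  by (intro integrable_abs Bochner_Integration.integrable_diff dens_integrable)

sublocale Metric_space "Mac lam" "rho_var lam"
proof
  fix mu nu ka
  show "0 \<le> rho_var lam mu nu" by (simp add: rho_var_def)
  show "rho_var lam mu nu = rho_var lam nu mu" by (simp add: rho_var_def abs_minus_commute)
  assume mu: "mu \<in> Mac lam" and nu: "nu \<in> Mac lam"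
  show "rho_var lam mu nu = 0 \<longleftrightarrow> mu = nu"
  proof
    assume "rho_var lam mu nu = 0"
    then have "AE x in lam. \<bar>dens lam mu x - dens lam nu x\<bar> = 0"
      using integral_nonneg_eq_0_iff_AE[OF rho_var_integrable[OF mu nu]] by (simp add: rho_var_def)
    then have "density lam (\<lambda>x. ennreal (dens lam mu x)) = density lam (\<lambda>x. ennreal (dens lam nu x))"
      by (intro density_cong) (auto elim!: eventually_mono)
    then show "mu = nu" by (simp add: density_dens mu nu)
  qed (simp add: rho_var_def)
  assume ka: "ka \<in> Mac lam"
  have "rho_var lam mu ka \<le> (\<integral>x. \<bar>dens lam mu x - dens lam nu x\<bar> + \<bar>dens lam nu x - dens lam ka x\<bar> \<partial>lam)"
    unfolding rho_var_def
    by (intro integral_mono Bochner_Integration.integrable_add rho_var_integrable mu nu ka) auto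
  also have "\<dots> = rho_var lam mu nu + rho_var lam nu ka"
    unfolding rho_var_def
    by (intro Bochner_Integration.integral_add rho_var_integrable mu nu ka)
  finally show "rho_var lam mu ka \<le> rho_var lam mu nu + rho_var lam nu ka" .
qed

lemma Mac_top_eq: "Mac_top lam = mtopology"
  by (simp add: Mac_top_def)

text \<open>The Riesz-Fischer argument for densities: along a subsequence with summable consecutive
  distances the telescoping series converges almost everywhere and, by domination, in L1.\<close>

lemma Mac_complete: mcomplete
  unfolding mcomplete_def
proof (intro allI impI)
  fix s assume s: "MCauchy s"
  have sM: "s n \<in> Mac lam" for n using s by (auto simp: MCauchy_def)
  have "\<exists>N. \<forall>n n'. N \<le> n \<longrightarrow> N \<le> n' \<longrightarrow> rho_var lam (s n) (s n') < (1/2)^k" for k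
    using s by (auto simp: MCauchy_def)
  then obtain N where N: "\<And>k n n'. N k \<le> n \<Longrightarrow> N k \<le> n' \<Longrightarrow> rho_var lam (s n) (s n') < (1/2)^k"
    by metis
  \<comment> \<open>The sum puts \<open>r k\<close> above \<open>N k\<close>; the summand
    \<open>k\<close> makes \<open>r\<close> strictly increasing.\<close>
  define r where "r k = k + (\<Sum>i\<le>k. N i)" for k
  have r_mono: "strict_mono r" unfolding r_def by (intro strict_monoI_Suc) simp
  have r_ge: "N k \<le> r k" for k
    unfolding r_def by (intro trans_le_add2 member_le_sum) auto
  define f where "f k = (\<lambda>x. dens lam (s (r (Suc k))) x - dens lam (s (r k)) x)" for k
  have int_f: "integrable lam (f k)" for k
    unfolding f_def by (intro Bochner_Integration.integrable_diff dens_integrable sM)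
  have [measurable]: "f k \<in> borel_measurable lam" for k using int_f by auto
  have f_le: "(\<integral>x. \<bar>f k x\<bar> \<partial>lam) \<le> (1/2)^k" for k
  proof -
    have "r k \<le> r (Suc k)" using r_mono by (simp add: strict_mono_less_eq)
    then have "rho_var lam (s (r (Suc k))) (s (r k)) < (1/2)^k"
      using r_ge[of k] by (intro N) auto
    then show ?thesis by (simp add: rho_var_def f_def)
  qed
  have sum_f: "summable (\<lambda>k. \<integral>x. \<bar>f k x\<bar> \<partial>lam)"
    by (rule summable_comparison_test[OF _ summable_geometric[of "1/2::real"]])
      (use f_le in auto)
  have AE_f: "AE x in lam. summable (\<lambda>k. \<bar>f k x\<bar>)"
    using AE_summable_of_summable_L1[OF int_f sum_f] .
  have int_abs: "integrable lam (\<lambda>x. \<Sum>k. \<bar>f k x\<bar>)"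
    using AE_f sum_f int_f by (intro integrable_suminf) auto
  have int_sum: "integrable lam (\<lambda>x. \<Sum>k. f k x)"
    using AE_f sum_f int_f by (intro integrable_suminf) auto
  define h0 where "h0 = dens lam (s (r 0))"
  \<comment> \<open>The series converges only almost everywhere. Cutting at 0 makes \<open>g\<close>
    nonnegative everywhere, as \<open>density_in_Mac\<close> requires, and does not alter a limit of
    nonnegative densities.\<close>
  define g where "g x = max (h0 x + (\<Sum>k. f k x)) 0" for x
  have int_g: "integrable lam g"
    unfolding g_def h0_def by (intro integrable_max Bochner_Integration.integrable_add dens_integrable sM int_sum) auto
  have g_nn: "0 \<le> g x" for x by (simp add: g_def)
  have [measurable]: "g \<in> borel_measurable lam" using int_g by auto
  have tele: "dens lam (s (r n)) x = h0 x + (\<Sum>k<n. f k x)" for n x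
    unfolding f_def h0_def by (subst sum_lessThan_telescope) simp
  have lim: "AE x in lam. (\<lambda>n. dens lam (s (r n)) x) \<longlonglongrightarrow> g x"
    using AE_f
  proof eventually_elim
    case (elim x)
    have "(\<lambda>n. dens lam (s (r n)) x) \<longlonglongrightarrow> h0 x + (\<Sum>k. f k x)"
      unfolding tele
      by (intro tendsto_add tendsto_const summable_LIMSEQ) (rule summable_rabs_cancel[OF elim])
    moreover from this have "0 \<le> h0 x + (\<Sum>k. f k x)"
      by (rule LIMSEQ_le_const) (auto simp: dens_nonneg)
    ultimately show ?case by (simp add: g_def)
  qed
  have "(\<lambda>n. \<integral>x. \<bar>dens lam (s (r n)) x - g x\<bar> \<partial>lam) \<longlonglongrightarrow> (\<integral>x. 0 \<partial>lam)"
  proof (rule integral_dominated_convergence[OF _ _ int_abs])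
    show "AE x in lam. (\<lambda>n. \<bar>dens lam (s (r n)) x - g x\<bar>) \<longlonglongrightarrow> 0"
      using lim
    proof eventually_elim
      case (elim x)
      then have "(\<lambda>n. \<bar>dens lam (s (r n)) x - g x\<bar>) \<longlonglongrightarrow> \<bar>g x - g x\<bar>"
        by (intro tendsto_intros)
      then show ?case by simp
    qed
    show "AE x in lam. norm \<bar>dens lam (s (r n)) x - g x\<bar> \<le> (\<Sum>k. \<bar>f k x\<bar>)" for n
      using lim AE_f
    proof eventually_elim
      case (elim x)
      have "\<bar>dens lam (s (r n)) x - dens lam (s (r m)) x\<bar> \<le> (\<Sum>k. \<bar>f k x\<bar>)" if "n \<le> m" for m
      proof -
        have "dens lam (s (r m)) x - dens lam (s (r n)) x = (\<Sum>k=n..<m. f k x)"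
          unfolding tele using that
          by (simp add: lessThan_atLeast0 sum_diff_nat_ivl)
        then have "\<bar>dens lam (s (r n)) x - dens lam (s (r m)) x\<bar> \<le> (\<Sum>k=n..<m. \<bar>f k x\<bar>)"
          by (metis abs_minus_commute sum_abs)
        also have "\<dots> \<le> (\<Sum>k. \<bar>f k x\<bar>)"
          using elim by (intro sum_le_suminf) auto
        finally show ?thesis .
      qed
      moreover have "(\<lambda>m. \<bar>dens lam (s (r n)) x - dens lam (s (r m)) x\<bar>) \<longlonglongrightarrow>
          \<bar>dens lam (s (r n)) x - g x\<bar>"
        using elim by (intro tendsto_intros)
      ultimately have "\<bar>dens lam (s (r n)) x - g x\<bar> \<le> (\<Sum>k. \<bar>f k x\<bar>)"
        by (intro LIMSEQ_le_const2) auto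
      then show ?case by simp
    qed
  qed auto
  then have "(\<lambda>n. rho_var lam (s (r n)) (density lam (\<lambda>x. ennreal (g x)))) \<longlonglongrightarrow> 0"
    using rho_var_density[OF int_g g_nn] by simp
  then have "limitin mtopology (s \<circ> r) (density lam (\<lambda>x. ennreal (g x))) sequentially"
    using density_in_Mac(1)[OF int_g g_nn] sM
    by (simp add: limitin_metric_dist_null o_def)
  then show "\<exists>x. limitin mtopology s x sequentially"
    using MCauchy_convergent_subsequence[OF s r_mono] by blast
qed

text \<open>Sigma-finiteness supplies an integrable \<open>w > 0\<close>. Dividing a density by
  \<open>w\<close> moves the approximation from L1 of \<open>lam\<close> to L1 of the finite measure
  with density \<open>w\<close>, where rational combinations of the bumps are dense; multiplying
  back yields countably many densities.\<close>

lemma Mac_separable: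
  obtains nu :: "nat \<Rightarrow> 'a measure" where "\<And>k. nu k \<in> Mac lam"
    and "\<And>mu e. mu \<in> Mac lam \<Longrightarrow> 0 < e \<Longrightarrow> \<exists>k. rho_var lam mu (nu k) < e"
proof -
  obtain b :: "nat \<Rightarrow> 'a \<Rightarrow> real"
    where b: "\<And>i. continuous_on UNIV (b i)" "\<And>i x. 0 \<le> b i x" "\<And>i x. b i x \<le> 1"
    and approx: "\<And>(K::'a measure) A e. finite_measure K \<Longrightarrow> sets K = sets borel \<Longrightarrow> A \<in> sets borel \<Longrightarrow> 0 < e \<Longrightarrow>
      \<exists>i. (\<integral>x. \<bar>indicator A x - b i x\<bar> \<partial>K) < e"
    using countable_bump_family by metis
  obtain h where h: "h \<in> borel_measurable lam" "integral\<^sup>N lam h \<noteq> \<infinity>"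
      "\<And>x. 0 < h x" "\<And>x. h x < \<infinity>"
    using Ex_finite_integrable_function by auto
  define w where "w x = enn2real (h x)" for x
  have w_pos: "0 < w x" for x using h(3,4)[of x] by (simp add: w_def enn2real_positive_iff)
  have w_h: "ennreal (w x) = h x" for x using h(4)[of x] by (simp add: w_def)
  have [measurable]: "w \<in> borel_measurable lam" unfolding w_def using h(1) by measurable
  have int_w: "integrable lam w"
    using h(2) w_pos by (intro integrableI_nonneg) (auto simp: w_h less_top less_imp_le)
  let ?K = "density lam (\<lambda>x. ennreal (w x))"
  have K: "finite_measure ?K" "sets ?K = sets borel"
    using density_in_Mac(1)[OF int_w] w_pos less_imp_le Mac_finite Mac_sets by blast+
  have b_meas [measurable]: "b i \<in> borel_measurable lam" for i
    unfolding borel_measurable_lam by (intro borel_measurable_continuous_onI b)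
  let ?G = "\<lambda>l x. (\<Sum>p\<leftarrow>l. of_rat (snd p) * b (fst p) x) :: real"
  have G_meas [measurable]: "?G l \<in> borel_measurable lam" for l :: "(nat \<times> rat) list"
    by (induction l) auto
  have G_bd: "\<exists>B. \<forall>x. \<bar>?G l x\<bar> \<le> B" for l :: "(nat \<times> rat) list"
  proof (induction l)
    case (Cons p l)
    then obtain B where B: "\<And>x. \<bar>?G l x\<bar> \<le> B" by auto
    have "\<bar>?G (p # l) x\<bar> \<le> \<bar>of_rat (snd p)\<bar> + B" for x
    proof -
      have "\<bar>of_rat (snd p) * b (fst p) x\<bar> \<le> \<bar>of_rat (snd p) :: real\<bar>"
        using b(2,3)[of "fst p" x] by (simp add: abs_mult mult_left_le)
      then show ?thesis using B[of x] by simp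
    qed
    then show ?case by blast
  qed auto
  \<comment> \<open>The approximant must be the density of a measure. Cutting at 0 does not increase
    the distance to \<open>dens lam mu x / w x\<close>, which is nonnegative.\<close>
  define gg where "gg l x = max (?G l x) 0 * w x" for l :: "(nat \<times> rat) list" and x
  have gg_nn: "0 \<le> gg l x" for l x using w_pos[of x] by (simp add: gg_def)
  have int_gg: "integrable lam (gg l)" for l
  proof -
    obtain B where B: "\<And>x. \<bar>?G l x\<bar> \<le> B" using G_bd by blast
    show ?thesis
    proof (rule Bochner_Integration.integrable_bound)
      show "integrable lam (\<lambda>x. B * w x)" using int_w by simp
      show "gg l \<in> borel_measurable lam" unfolding gg_def by measurable
      have "\<bar>gg l x\<bar> \<le> \<bar>B * w x\<bar>" for x
        unfolding gg_def abs_mult using B[of x] by (intro mult_right_mono) auto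
      then show "AE x in lam. norm (gg l x) \<le> norm (B * w x)" by simp
    qed
  qed
  define nu where "nu k = density lam (\<lambda>x. ennreal (gg (from_nat k) x))" for k
  show ?thesis
  proof
    show "nu k \<in> Mac lam" for k unfolding nu_def by (intro density_in_Mac int_gg gg_nn)
    fix mu and e :: real assume mu: "mu \<in> Mac lam" and e: "0 < e"
    let ?phi = "\<lambda>x. dens lam mu x / w x"
    have "integrable ?K ?phi"
      using dens_integrable[OF mu] w_pos less_imp_le[OF w_pos]
      by (subst integrable_density) (auto simp: less_imp_neq[symmetric])
    then obtain l :: "(nat \<times> rat) list" where l: "(\<integral>x. \<bar>?phi x - ?G l x\<bar> \<partial>?K) < e"
      using L1_dense_family[OF K(1), of b ?phi e] b(2,3) approx[OF K] K(2) e by auto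
    have "rho_var lam mu (nu (to_nat l)) = (\<integral>x. \<bar>dens lam mu x - gg l x\<bar> \<partial>lam)"
      unfolding nu_def using rho_var_density[OF int_gg gg_nn] by simp
    also have "\<dots> \<le> (\<integral>x. w x * \<bar>?phi x - ?G l x\<bar> \<partial>lam)"
    proof (rule integral_mono')
      have "integrable ?K (\<lambda>x. \<bar>?phi x - ?G l x\<bar>)"
      proof -
        obtain B where B: "\<And>x. \<bar>?G l x\<bar> \<le> B" using G_bd by blast
        interpret K: finite_measure ?K by fact
        have "integrable ?K (?G l)"
          using B by (intro K.integrable_const_bound[of _ B]) auto
        then show ?thesis using \<open>integrable ?K ?phi\<close> by auto
      qed
      then show "integrable lam (\<lambda>x. w x * \<bar>?phi x - ?G l x\<bar>)"
        using w_pos less_imp_le[OF w_pos] by (subst (asm) integrable_density) auto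
      fix x
      have "\<bar>?phi x - max (?G l x) 0\<bar> \<le> \<bar>?phi x - ?G l x\<bar>"
        using divide_nonneg_pos[OF dens_nonneg[of mu x] w_pos[of x]] by auto
      then have "w x * \<bar>?phi x - max (?G l x) 0\<bar> \<le> w x * \<bar>?phi x - ?G l x\<bar>"
        using w_pos[of x] by (intro mult_left_mono) auto
      moreover have "w x * \<bar>?phi x - max (?G l x) 0\<bar> = \<bar>w x * (?phi x - max (?G l x) 0)\<bar>"
        using w_pos[of x] by (simp add: abs_mult)
      moreover have "w x * (?phi x - max (?G l x) 0) = dens lam mu x - gg l x"
        using w_pos[of x] by (simp add: gg_def algebra_simps)
      ultimately show "\<bar>dens lam mu x - gg l x\<bar> \<le> w x * \<bar>?phi x - ?G l x\<bar>" by simp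
      show "0 \<le> w x * \<bar>?phi x - ?G l x\<bar>" using w_pos[of x] by simp
    qed
    also have "\<dots> = (\<integral>x. \<bar>?phi x - ?G l x\<bar> \<partial>?K)"
      using w_pos less_imp_le[OF w_pos] by (subst integral_density) auto
    also note l
    finally show "\<exists>k. rho_var lam mu (nu k) < e" by blast
  qed
qed

lemma integral_diff_le_rho_var:
  fixes f :: "'a \<Rightarrow> real"
  assumes mu: "mu \<in> Mac lam" and nu: "nu \<in> Mac lam"
    and f: "f \<in> borel_measurable borel" "\<And>x. \<bar>f x\<bar> \<le> 1"
  shows "\<bar>(\<integral>x. f x \<partial>mu) - (\<integral>x. f x \<partial>nu)\<bar> \<le> rho_var lam mu nu"
proof -
  have [measurable]: "f \<in> borel_measurable lam" using f(1) by (simp add: borel_measurable_lam)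
  have int: "integrable lam (\<lambda>x. dens lam ka x * f x)" if "ka \<in> Mac lam" for ka
    using dens_integrable[OF that]
    by (rule Bochner_Integration.integrable_bound) (use f(2) in \<open>auto simp: abs_mult mult_left_le\<close>)
  have "(\<integral>x. f x \<partial>mu) - (\<integral>x. f x \<partial>nu) = (\<integral>x. (dens lam mu x - dens lam nu x) * f x \<partial>lam)"
    using int[OF mu] int[OF nu] by (simp add: integral_Mac mu nu f left_diff_distrib)
  also have "\<bar>\<dots>\<bar> \<le> (\<integral>x. \<bar>(dens lam mu x - dens lam nu x) * f x\<bar> \<partial>lam)"
    by (rule integral_abs_bound)
  also have "\<dots> \<le> rho_var lam mu nu"
    unfolding rho_var_def
    by (intro integral_mono' rho_var_integrable mu nu) (auto simp: abs_mult f(2) mult_left_le)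
  finally show ?thesis .
qed

text \<open>Total variation is attained by the sign of the difference of densities, that is, by
  \<open>2 * indicator A - 1\<close> for the set \<open>A\<close> where the difference is
  nonnegative. Replacing \<open>indicator A\<close> by a nearby \<open>b i\<close>, in L1 of the
  measure whose density is the absolute difference, gives \<open>f i = 2 * b i - 1\<close>.\<close>

lemma rho_var_eq_Sup_family:
  obtains f :: "nat \<Rightarrow> 'a \<Rightarrow> real" where "\<And>i. continuous_on UNIV (f i)" "\<And>i x. \<bar>f i x\<bar> \<le> 1"
    and "\<And>mu nu e. mu \<in> Mac lam \<Longrightarrow> nu \<in> Mac lam \<Longrightarrow> 0 < e \<Longrightarrow>
      \<exists>i. rho_var lam mu nu - e < (\<integral>x. f i x \<partial>mu) - (\<integral>x. f i x \<partial>nu)"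
proof -
  obtain b :: "nat \<Rightarrow> 'a \<Rightarrow> real"
    where b: "\<And>i. continuous_on UNIV (b i)" "\<And>i x. 0 \<le> b i x" "\<And>i x. b i x \<le> 1"
    and approx: "\<And>(K::'a measure) A e. finite_measure K \<Longrightarrow> sets K = sets borel \<Longrightarrow> A \<in> sets borel \<Longrightarrow> 0 < e \<Longrightarrow>
      \<exists>i. (\<integral>x. \<bar>indicator A x - b i x\<bar> \<partial>K) < e"
    using countable_bump_family by metis
  define f where "f i x = 2 * b i x - 1" for i x
  have f_cont: "continuous_on UNIV (f i)" for i
    unfolding f_def by (intro continuous_intros b)
  have f_bd: "\<bar>f i x\<bar> \<le> 1" for i x
    using b(2,3)[of i x] by (auto simp: f_def)
  have f_borel: "f i \<in> borel_measurable borel" "b i \<in> borel_measurable borel" for i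
    by (intro borel_measurable_continuous_onI f_cont b)+
  then have [measurable]: "f i \<in> borel_measurable lam" "b i \<in> borel_measurable lam" for i
    by (simp_all add: borel_measurable_lam)
  show ?thesis
  proof
    show "continuous_on UNIV (f i)" "\<bar>f i x\<bar> \<le> 1" for i x by fact+
    fix mu nu and e :: real assume mu: "mu \<in> Mac lam" and nu: "nu \<in> Mac lam" and e: "0 < e"
    let ?d = "\<lambda>x. dens lam mu x - dens lam nu x"
    let ?K = "density lam (\<lambda>x. ennreal \<bar>?d x\<bar>)"
    let ?A = "{x \<in> space lam. dens lam nu x \<le> dens lam mu x}"
    have A [measurable]: "?A \<in> sets lam" by measurable
    have K: "finite_measure ?K" "sets ?K = sets borel"
      using density_in_Mac(1)[OF rho_var_integrable[OF mu nu] abs_ge_zero]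
      by (rule Mac_finite, rule Mac_sets)
    \<comment> \<open>The factor 2 in \<open>f i\<close> doubles this error to
      \<open>e\<close>.\<close>
    obtain i where i: "(\<integral>x. \<bar>indicator ?A x - b i x\<bar> \<partial>?K) < e / 2"
      using approx[OF K, of ?A "e/2"] A lam_borel e by auto
    have int: "integrable lam (\<lambda>x. dens lam ka x * f i x)" if "ka \<in> Mac lam" for ka
      using dens_integrable[OF that]
      by (rule Bochner_Integration.integrable_bound) (use f_bd in \<open>auto simp: abs_mult mult_left_le\<close>)
    have int2: "integrable lam (\<lambda>x. ?d x * f i x)"
      using int[OF mu] int[OF nu] by (simp add: left_diff_distrib)
    have diff: "(\<integral>x. f i x \<partial>mu) - (\<integral>x. f i x \<partial>nu) = (\<integral>x. ?d x * f i x \<partial>lam)"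
      using int[OF mu] int[OF nu] by (simp add: integral_Mac mu nu f_borel left_diff_distrib)
    have bd1: "\<bar>indicator ?A x - b i x\<bar> \<le> 1" for x
      using b(2,3)[of i x] by (auto simp: indicator_def)
    have int3: "integrable lam (\<lambda>x. \<bar>?d x\<bar> * \<bar>indicator ?A x - b i x\<bar>)"
      using rho_var_integrable[OF mu nu]
      by (rule Bochner_Integration.integrable_bound)
        (use bd1 in \<open>auto simp: abs_mult mult_left_le\<close>)
    have "rho_var lam mu nu \<le> (\<integral>x. ?d x * f i x + 2 * (\<bar>?d x\<bar> * \<bar>indicator ?A x - b i x\<bar>) \<partial>lam)"
      unfolding rho_var_def
    proof (rule integral_mono)
      show "integrable lam (\<lambda>x. ?d x * f i x + 2 * (\<bar>?d x\<bar> * \<bar>indicator ?A x - b i x\<bar>))"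
        using int2 int3 by auto
      fix x assume "x \<in> space lam"
      have "\<bar>?d x\<bar> = ?d x * (2 * indicator ?A x - 1)"
        by (auto simp: indicator_def)
      also have "\<dots> = ?d x * f i x + 2 * (?d x * (indicator ?A x - b i x))"
        by (simp add: f_def algebra_simps)
      also have "\<dots> \<le> ?d x * f i x + 2 * (\<bar>?d x\<bar> * \<bar>indicator ?A x - b i x\<bar>)"
        using abs_ge_self[of "?d x * (indicator ?A x - b i x)"] by (simp add: abs_mult)
      finally show "\<bar>?d x\<bar> \<le> ?d x * f i x + 2 * (\<bar>?d x\<bar> * \<bar>indicator ?A x - b i x\<bar>)" .
    qed (intro rho_var_integrable mu nu)
    also have "\<dots> = (\<integral>x. ?d x * f i x \<partial>lam) + 2 * (\<integral>x. \<bar>?d x\<bar> * \<bar>indicator ?A x - b i x\<bar> \<partial>lam)"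
      using int2 int3 by simp
    also have "(\<integral>x. \<bar>?d x\<bar> * \<bar>indicator ?A x - b i x\<bar> \<partial>lam) = (\<integral>x. \<bar>indicator ?A x - b i x\<bar> \<partial>?K)"
      by (subst integral_density) auto
    finally show "\<exists>i. rho_var lam mu nu - e < (\<integral>x. f i x \<partial>mu) - (\<integral>x. f i x \<partial>nu)"
      using i diff by (intro exI[of _ i]) linarith
  qed
qed

lemma continuous_map_integral_Mac:
  fixes f :: "'a \<Rightarrow> real"
  assumes f: "f \<in> borel_measurable borel" "\<And>x. \<bar>f x\<bar> \<le> 1"
  shows "continuous_map mtopology euclideanreal (\<lambda>mu. \<integral>x. f x \<partial>mu)"
proof -
  have "continuous_map mtopology (Met_TC.mtopology) (\<lambda>mu. \<integral>x. f x \<partial>mu)"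
    unfolding metric_continuous_map[OF Met_TC.Metric_space_axioms]
  proof (intro conjI ballI allI impI)
    fix mu and e :: real assume mu: "mu \<in> Mac lam" and e: "0 < e"
    then show "\<exists>d>0. \<forall>nu. nu \<in> Mac lam \<and> rho_var lam mu nu < d \<longrightarrow>
        dist (\<integral>x. f x \<partial>mu) (\<integral>x. f x \<partial>nu) < e"
      using integral_diff_le_rho_var[OF mu _ f]
      by (intro exI[of _ e]) (auto simp: dist_real_def intro: le_less_trans)
  qed auto
  then show ?thesis by simp
qed

lemma Pac_closed: "closedin mtopology (Pac lam)"
proof -
  have Pac_eq: "Pac lam = {mu \<in> topspace mtopology. (\<integral>x. 1 \<partial>mu) \<in> {1::real}}"
  proof -
    have "emeasure mu (space mu) = 1 \<longleftrightarrow> (\<integral>x. 1 \<partial>mu) = (1::real)" if "mu \<in> Mac lam" for mu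
    proof -
      interpret finite_measure mu using that by (rule Mac_finite)
      show ?thesis by (simp add: emeasure_eq_measure)
    qed
    then show ?thesis by (auto simp: Pac_def)
  qed
  have "continuous_map mtopology euclideanreal (\<lambda>mu. \<integral>x. 1 \<partial>mu)"
    by (rule continuous_map_integral_Mac) auto
  then show ?thesis
    unfolding Pac_eq by (rule closedin_continuous_map_preimage) auto
qed

end

section \<open>Smooth minima of maxima\<close>

text \<open>A partition function: \<open>ln (lse_weight m c k x) / m\<close> is the soft maximum of
  \<open>x j - c k j\<close>, and the reciprocal of the weight is the exponential of minus
  \<open>m\<close> times it, as a soft minimum needs. Using \<open>m\<close> both as number of
  functionals and as inverse temperature lets one limit send both to infinity.\<close>

definition lse_weight :: "nat \<Rightarrow> (nat \<Rightarrow> nat \<Rightarrow> real) \<Rightarrow> nat \<Rightarrow> (nat \<Rightarrow> real) \<Rightarrow> real" where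
  "lse_weight m c k x = (\<Sum>j<m. exp (real m * (x j - c k j)))"

text \<open>At inverse temperature \<open>m\<close> the function \<open>softminmax n m c\<close> is the soft minimum over
  \<open>k \<le> n\<close> of the soft maxima over \<open>j < m\<close> of \<open>x j - c k j\<close>. Its gradient is a probability
  vector.\<close>

definition softminmax :: "nat \<Rightarrow> nat \<Rightarrow> (nat \<Rightarrow> nat \<Rightarrow> real) \<Rightarrow> (nat \<Rightarrow> real) \<Rightarrow> real" where
  "softminmax n m c x = - (ln (\<Sum>k\<le>n. inverse (lse_weight m c k x)) / real m)"

text \<open>A sum over \<open>k\<close> of products of two Gibbs weights: that of \<open>k\<close>
  in the soft minimum and that of \<open>i\<close> in the soft maximum of row \<open>k\<close>. The
  factor \<open>m\<close> from the exponentials cancels against the division by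
  \<open>m\<close>.\<close>

definition softminmax_pd :: "nat \<Rightarrow> nat \<Rightarrow> (nat \<Rightarrow> nat \<Rightarrow> real) \<Rightarrow> nat \<Rightarrow> (nat \<Rightarrow> real) \<Rightarrow> real" where
  "softminmax_pd n m c i x =
    (\<Sum>k\<le>n. (inverse (lse_weight m c k x))\<^sup>2 * exp (real m * (x i - c k i))) /
    (\<Sum>k\<le>n. inverse (lse_weight m c k x))"

context
  fixes n m :: nat and c :: "nat \<Rightarrow> nat \<Rightarrow> real"
  assumes m: "0 < m"
begin

lemma lse_weight_pos: "0 < lse_weight m c k x"
  unfolding lse_weight_def using m by (intro sum_pos) auto

lemma sum_inverse_lse_weight_pos: "0 < (\<Sum>k\<le>n. inverse (lse_weight m c k x))"
  using lse_weight_pos by (intro sum_pos) auto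

lemma lse_weight_has_derivative:
  assumes "i < m"
  shows "((\<lambda>t. lse_weight m c k (x(i := t))) has_real_derivative
    real m * exp (real m * (x i - c k i))) (at (x i))"
proof -
  have "((\<lambda>t. exp (real m * ((x(i := t)) j - c k j))) has_real_derivative
      (if j = i then real m * exp (real m * (x i - c k i)) else 0)) (at (x i))" for j
    by (cases "j = i") (auto intro!: derivative_eq_intros)
  then have "((\<lambda>t. \<Sum>j<m. exp (real m * ((x(i := t)) j - c k j))) has_real_derivative
      (\<Sum>j<m. if j = i then real m * exp (real m * (x i - c k i)) else 0)) (at (x i))"
    by (intro DERIV_sum)
  then show ?thesis
    unfolding lse_weight_def using assms by simp
qed

lemma softminmax_has_derivative:
  assumes "i < m"
  shows "((\<lambda>t. softminmax n m c (x(i := t))) has_real_derivative softminmax_pd n m c i x) (at (x i))"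
proof -
  have "((\<lambda>t. inverse (lse_weight m c k (x(i := t)))) has_real_derivative
      - (real m * ((inverse (lse_weight m c k x))\<^sup>2 * exp (real m * (x i - c k i))))) (at (x i))" for k
    using lse_weight_has_derivative[OF assms, of k x] lse_weight_pos[of k x]
    by (auto intro!: derivative_eq_intros simp: power2_eq_square)
  then have "((\<lambda>t. \<Sum>k\<le>n. inverse (lse_weight m c k (x(i := t)))) has_real_derivative
      (\<Sum>k\<le>n. - (real m * ((inverse (lse_weight m c k x))\<^sup>2 * exp (real m * (x i - c k i)))))) (at (x i))"
    by (intro DERIV_sum)
  then have T: "((\<lambda>t. \<Sum>k\<le>n. inverse (lse_weight m c k (x(i := t)))) has_real_derivative
      - (real m * (\<Sum>k\<le>n. (inverse (lse_weight m c k x))\<^sup>2 * exp (real m * (x i - c k i))))) (at (x i))"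
    by (simp add: sum_negf sum_distrib_left)
  have "0 < (\<Sum>k\<le>n. inverse (lse_weight m c k (x(i := x i))))"
    by (rule sum_inverse_lse_weight_pos)
  from DERIV_minus[OF DERIV_cdivide[OF DERIV_chain2[OF DERIV_ln[OF this] T]], of "real m"]
  show ?thesis
    unfolding softminmax_def softminmax_pd_def using m by (simp add: field_simps)
qed

lemma softminmax_pd_nonneg: "0 \<le> softminmax_pd n m c i x"
  unfolding softminmax_pd_def using sum_inverse_lse_weight_pos[of x]
  by (intro divide_nonneg_pos sum_nonneg) auto

text \<open>Summing over \<open>i\<close> turns the exponentials into \<open>lse_weight\<close>,
  which cancels one of the two reciprocals; what remains is the denominator.\<close>

lemma softminmax_pd_sum: "(\<Sum>i<m. softminmax_pd n m c i x) = 1"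
proof -
  have "(\<Sum>i<m. \<Sum>k\<le>n. (inverse (lse_weight m c k x))\<^sup>2 * exp (real m * (x i - c k i))) =
      (\<Sum>k\<le>n. (inverse (lse_weight m c k x))\<^sup>2 * lse_weight m c k x)"
    by (subst sum.swap) (simp add: lse_weight_def sum_distrib_left)
  also have "\<dots> = (\<Sum>k\<le>n. inverse (lse_weight m c k x))"
    using lse_weight_pos[THEN less_imp_neq] by (intro sum.cong) (auto simp: power2_eq_square)
  finally show ?thesis
    unfolding softminmax_pd_def using sum_inverse_lse_weight_pos[of x]
    by (simp flip: sum_divide_distrib)
qed

lemma continuous_on_lse_weight: "continuous_on UNIV (lse_weight m c k)"
  unfolding lse_weight_def[abs_def] by (intro continuous_intros continuous_on_product_coordinates)

lemma continuous_on_softminmax: "continuous_on UNIV (softminmax n m c)"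
  unfolding softminmax_def[abs_def]
  using sum_inverse_lse_weight_pos[THEN less_imp_neq] lse_weight_pos[THEN less_imp_neq] m
  by (intro continuous_intros continuous_on_lse_weight) auto

lemma continuous_on_softminmax_pd: "continuous_on UNIV (softminmax_pd n m c i)"
  unfolding softminmax_pd_def[abs_def]
  using sum_inverse_lse_weight_pos[THEN less_imp_neq] lse_weight_pos[THEN less_imp_neq]
  by (intro continuous_intros continuous_on_lse_weight continuous_on_product_coordinates) auto

lemma softminmax_cong: "(\<And>j. j < m \<Longrightarrow> x j = y j) \<Longrightarrow> softminmax n m c x = softminmax n m c y"
  by (simp add: softminmax_def lse_weight_def)

lemma arctan_softminmax_has_derivative:
  assumes "i < m"
  shows "((\<lambda>t. arctan (softminmax n m c (x(i := t)))) has_real_derivative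
    inverse (1 + (softminmax n m c x)\<^sup>2) * softminmax_pd n m c i x) (at (x i))"
  using DERIV_chain2[OF DERIV_arctan softminmax_has_derivative[OF assms, of x]] by simp

lemma pd_arctan_softminmax:
  assumes "i < m"
  shows "pd i (\<lambda>x. arctan (softminmax n m c x)) x =
    inverse (1 + (softminmax n m c x)\<^sup>2) * softminmax_pd n m c i x"
  unfolding pd_def by (rule DERIV_imp_deriv[OF arctan_softminmax_has_derivative[OF assms]])

lemma pd_arctan_softminmax_bounds:
  assumes "i < m"
  shows "0 \<le> pd i (\<lambda>x. arctan (softminmax n m c x)) x"
    and "pd i (\<lambda>x. arctan (softminmax n m c x)) x \<le> softminmax_pd n m c i x"
proof -
  have "0 < 1 + (softminmax n m c x)\<^sup>2" by (simp add: add_pos_nonneg)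
  moreover have "inverse (1 + (softminmax n m c x)\<^sup>2) \<le> 1"
    by (rule inverse_le_1_iff[THEN iffD2]) auto
  ultimately show "0 \<le> pd i (\<lambda>x. arctan (softminmax n m c x)) x"
    "pd i (\<lambda>x. arctan (softminmax n m c x)) x \<le> softminmax_pd n m c i x"
    unfolding pd_arctan_softminmax[OF assms] using softminmax_pd_nonneg[of i x]
    by (auto intro: mult_left_le_one_le)
qed

lemma sum_pd_arctan_softminmax: "(\<Sum>i<m. pd i (\<lambda>x. arctan (softminmax n m c x)) x) \<le> 1"
proof -
  have "(\<Sum>i<m. pd i (\<lambda>x. arctan (softminmax n m c x)) x) \<le> (\<Sum>i<m. softminmax_pd n m c i x)"
    by (intro sum_mono pd_arctan_softminmax_bounds) auto
  then show ?thesis by (simp add: softminmax_pd_sum)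
qed

lemma C1b_arctan_softminmax: "C1b m (\<lambda>x. arctan (softminmax n m c x))"
  unfolding C1b_def
proof (intro conjI allI impI)
  fix x y :: "nat \<Rightarrow> real" assume "\<forall>j<m. x j = y j"
  then show "arctan (softminmax n m c x) = arctan (softminmax n m c y)"
    using softminmax_cong by metis
next
  have "\<bar>arctan y\<bar> \<le> pi / 2" for y using arctan_bounded[of y] by auto
  then show "bounded (range (\<lambda>x. arctan (softminmax n m c x)))"
    unfolding bounded_iff by (intro exI[of _ "pi / 2"]) auto
next
  fix i x assume i: "i < m"
  show "((\<lambda>t. arctan (softminmax n m c (x(i := t)))) has_real_derivative
      pd i (\<lambda>x. arctan (softminmax n m c x)) x) (at (x i))"
    unfolding pd_arctan_softminmax[OF i] by (rule arctan_softminmax_has_derivative[OF i])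
next
  fix i assume i: "i < m"
  have "1 + (softminmax n m c x)\<^sup>2 \<noteq> 0" for x
    by (metis add_pos_nonneg less_numeral_extra(1,3) zero_le_power2)
  then show "continuous_on UNIV (pd i (\<lambda>x. arctan (softminmax n m c x)))"
    unfolding pd_arctan_softminmax[OF i, abs_def]
    by (intro continuous_intros continuous_on_softminmax continuous_on_softminmax_pd) auto
  have "\<bar>pd i (\<lambda>x. arctan (softminmax n m c x)) x\<bar> \<le> 1" for x
  proof -
    have "softminmax_pd n m c i x \<le> (\<Sum>i<m. softminmax_pd n m c i x)"
      using i softminmax_pd_nonneg by (intro member_le_sum) auto
    then show ?thesis
      using pd_arctan_softminmax_bounds[OF i, of x] softminmax_pd_sum[of x] by simp
  qed
  then show "bounded (range (pd i (\<lambda>x. arctan (softminmax n m c x))))"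
    by (auto simp: bounded_iff)
qed

end

text \<open>Soft and true extrema differ by at most \<open>ln m / m\<close> for a maximum over
  \<open>m\<close> terms and \<open>ln (n+1) / m\<close> for the minimum over \<open>n+1\<close>
  rows. The supremum over all \<open>j\<close> is nearly reached at one index for each
  \<open>k \<le> n\<close>, and these finitely many indices are eventually below \<open>m\<close>.
  \<open>Suc m\<close> avoids inverse temperature 0.\<close>

lemma softminmax_tendsto:
  fixes r :: "nat \<Rightarrow> real"
  assumes le: "\<And>k j. x j - c k j \<le> r k"
    and ex: "\<And>k e. 0 < e \<Longrightarrow> \<exists>j. r k - e < x j - c k j"
  shows "(\<lambda>m. softminmax n (Suc m) c x) \<longlonglongrightarrow> Min (r ` {..n})"
proof (rule LIMSEQ_Suc, rule LIMSEQ_I)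
  fix e :: real assume e: "0 < e"
  define R where "R = Min (r ` {..n})"
  have R_le: "R \<le> r k" if "k \<le> n" for k unfolding R_def using that by (intro Min_le) auto
  have "R \<in> r ` {..n}" unfolding R_def by (intro Min_in) auto
  then obtain k0 where k0: "k0 \<le> n" "r k0 = R" by auto
  obtain j where j: "\<And>k. r k - e / 2 < x (j k) - c k (j k)"
    using ex[of "e/2"] e by (metis half_gt_zero)
  define M where "M = Max (j ` {..n})"
  have M: "j k \<le> M" if "k \<le> n" for k unfolding M_def using that by (intro Max_ge) auto
  have "eventually (\<lambda>m. ln (real m) / real m < e) sequentially"
    using e by (intro order_tendstoD(2)[OF lim_ln_over_n]) auto
  moreover have "eventually (\<lambda>m. ln (real (Suc n)) / real m < e / 2) sequentially"
    using e by (intro order_tendstoD(2)[OF lim_const_over_n]) auto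
  ultimately have "eventually (\<lambda>m. norm (softminmax n m c x - R) < e) sequentially"
    using eventually_gt_at_top[of M]
  proof eventually_elim
    case (elim m)
    then have m: "0 < m" by simp
    let ?S = "\<lambda>k. lse_weight m c k x"
    let ?T = "\<Sum>k\<le>n. inverse (?S k)"
    note T_pos = sum_inverse_lse_weight_pos[OF m, of c x n]
    \<comment> \<open>Upper bound: the single row \<open>k0\<close> already bounds \<open>?T\<close>
      from below.\<close>
    have "?S k0 \<le> real (card {..<m}) * exp (real m * R)"
      unfolding lse_weight_def using le[of _ k0] k0 by (intro sum_bounded_above) auto
    then have "?S k0 \<le> exp (ln (real m) + real m * R)"
      using m by (simp add: exp_add)
    then have "exp (- (ln (real m) + real m * R)) \<le> inverse (?S k0)"
      unfolding exp_minus using lse_weight_pos[OF m] by (intro le_imp_inverse_le)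
    also have "\<dots> \<le> ?T"
      using k0 lse_weight_pos[OF m, of c _ x] by (intro member_le_sum) (auto intro: less_imp_le)
    finally have "- (ln (real m) + real m * R) \<le> ln ?T"
      using T_pos by (simp add: ln_ge_iff)
    then have up: "softminmax n m c x \<le> R + ln (real m) / real m"
      unfolding softminmax_def using m by (simp add: field_simps)
    \<comment> \<open>Lower bound: one nearly maximal term bounds each row sum from below.\<close>
    have "inverse (?S k) \<le> exp (- (real m * (R - e / 2)))" if "k \<le> n" for k
    proof -
      have "exp (real m * (R - e / 2)) \<le> exp (real m * (x (j k) - c k (j k)))"
        using j[of k] R_le[OF that] m by simp
      also have "\<dots> \<le> ?S k"
        unfolding lse_weight_def using M[OF that] elim by (intro member_le_sum) auto
      finally show ?thesis
        unfolding exp_minus by (intro le_imp_inverse_le) auto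
    qed
    then have "?T \<le> real (card {..n}) * exp (- (real m * (R - e / 2)))"
      by (intro sum_bounded_above) auto
    also have "real (card {..n}) = exp (ln (real (Suc n)))"
      by (simp only: card_atMost exp_ln of_nat_0_less_iff zero_less_Suc)
    also note exp_add[symmetric]
    finally have "ln ?T \<le> ln (exp (ln (real (Suc n)) + - (real m * (R - e / 2))))"
      using T_pos by (intro ln_mono) auto
    then have "ln ?T \<le> ln (real (Suc n)) + - (real m * (R - e / 2))"
      by (simp only: ln_exp)
    then have "ln ?T / real m \<le> (ln (real (Suc n)) + - (real m * (R - e / 2))) / real m"
      by (rule divide_right_mono) simp
    also have "\<dots> = ln (real (Suc n)) / real m - (R - e / 2)"
      unfolding add_divide_distrib using m by simp
    finally have "R - e / 2 - ln (real (Suc n)) / real m \<le> softminmax n m c x"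
      unfolding softminmax_def by linarith
    then show ?case using up elim by (simp add: abs_less_iff)
  qed
  then show "\<exists>no. \<forall>m\<ge>no. norm (softminmax n m c x - Min (r ` {..n})) < e"
    by (simp add: eventually_sequentially R_def)
qed

section \<open>Quasi-regularity\<close>

lemma space_borel_of [simp]: "space (borel_of X) = topspace X"
  unfolding borel_of_def by (rule space_measure_of) (auto dest: openin_subset)

lemma closedin_sets_borel_of:
  assumes "closedin X A" shows "A \<in> sets (borel_of X)"
proof -
  have "openin X (topspace X - A)" using assms by (simp add: closedin_def)
  then have "topspace X - A \<in> sets (borel_of X)"
    unfolding borel_of_def by (subst sets_measure_of) (auto dest: openin_subset)
  from sets.compl_sets[OF this] show ?thesis
    using closedin_subset[OF assms] by (simp add: double_diff)
qed

section \<open>Uniform bounds for cylinder functions with subprobability gradient\<close>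

lemma Linf_norm_le: "AE x in mu. \<bar>k x\<bar> \<le> c \<Longrightarrow> Linf_norm mu k \<le> ennreal c"
  unfolding Linf_norm_def by (rule INF_lower) (auto elim!: eventually_mono intro: ennreal_leI)

lemma abs_weighted_sum_le:
  fixes p a :: "nat \<Rightarrow> real"
  assumes "\<And>i. i < n \<Longrightarrow> 0 \<le> p i" "(\<Sum>i<n. p i) \<le> 1" "\<And>i. i < n \<Longrightarrow> \<bar>a i\<bar> \<le> c" "0 \<le> c"
  shows "\<bar>\<Sum>i<n. p i * a i\<bar> \<le> c"
proof -
  have "\<bar>\<Sum>i<n. p i * a i\<bar> \<le> (\<Sum>i<n. \<bar>p i * a i\<bar>)" by (rule sum_abs)
  also have "\<dots> \<le> (\<Sum>i<n. p i * c)"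
    using assms(1,3) by (intro sum_mono) (auto simp: abs_mult intro!: mult_left_mono)
  also have "\<dots> = (\<Sum>i<n. p i) * c" by (simp add: sum_distrib_right)
  also have "\<dots> \<le> 1 * c" using assms(2,4) by (intro mult_right_mono)
  finally show ?thesis by simp
qed

text \<open>The class on which both alternatives of the theorem lead to the same kind of energy
  bound: weights of sum at most 1 on functions bounded by 1 keep the extrinsic derivative bounded by
  1. The last constant 2 is a bound for \<open>arctan\<close>, as \<open>pi < 4\<close>.\<close>

definition convex_cyl :: "nat \<Rightarrow> (nat \<Rightarrow> 'a::topological_space \<Rightarrow> real) \<Rightarrow> ((nat \<Rightarrow> real) \<Rightarrow> real) \<Rightarrow> bool" where
  "convex_cyl n f g \<longleftrightarrow> cyl_data n f g \<and> (\<forall>i<n. \<forall>x. \<bar>f i x\<bar> \<le> 1) \<and>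
    (\<forall>x. \<forall>i<n. 0 \<le> pd i g x) \<and> (\<forall>x. (\<Sum>i<n. pd i g x) \<le> 1) \<and> (\<forall>x. \<bar>g x\<bar> \<le> 2)"

lemma convex_cyl_arctan_softminmax:
  assumes "0 < m" "\<And>i. continuous_on UNIV (f i)" "\<And>i x. \<bar>f i x\<bar> \<le> 1"
  shows "convex_cyl m f (\<lambda>x. arctan (softminmax n m c x))"
proof -
  have "\<bar>arctan y\<bar> \<le> 2" for y using arctan_bounded[of y] pi_less_4 by (auto simp: abs_le_iff)
  moreover have "Cb (f i)" for i
    unfolding Cb_def bounded_iff using assms(2,3)[of i] by auto
  ultimately show ?thesis
    using assms by (auto simp: convex_cyl_def cyl_data_def C1b_arctan_softminmax
        pd_arctan_softminmax_bounds sum_pd_arctan_softminmax)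
qed

lemma convex_cyl_sup_norm:
  "convex_cyl n f g \<Longrightarrow> sup_norm A (cyl f g) \<le> 2"
  unfolding sup_norm_def convex_cyl_def cyl_def
  by (intro SUP_least) (metis ennreal_leI ennreal_numeral zero_le_numeral)

text \<open>The whole derivative is put into the L-infinity summand, with 0 as L1 summand. The bound
  1 is rounded up to match \<open>convex_cyl_DE_tilde\<close>.\<close>

lemma convex_cyl_DE:
  assumes "convex_cyl n f g" "mu \<in> Mac lam"
  shows "L1_plus_Linf_norm mu (DE n f g mu) \<le> 2"
proof -
  have sets: "sets mu = sets borel" using assms(2) by (auto simp: Mac_def fin_meas_def)
  have "\<bar>DE n f g mu x\<bar> \<le> 1" for x
    unfolding DE_def using assms(1) by (intro abs_weighted_sum_le) (auto simp: convex_cyl_def)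
  then have le: "Linf_norm mu (DE n f g mu) \<le> 1"
    using Linf_norm_le[where mu = mu and c = 1 and k = "DE n f g mu"] by simp
  have "f i \<in> borel_measurable mu" if "i < n" for i
  proof -
    have "f i \<in> borel_measurable borel"
      using assms(1) that by (intro borel_measurable_continuous_onI)
        (auto simp: convex_cyl_def cyl_data_def Cb_def)
    then show ?thesis using sets by (simp cong: measurable_cong_sets)
  qed
  then have meas: "DE n f g mu \<in> borel_measurable mu"
    unfolding DE_def[abs_def] by (intro borel_measurable_sum borel_measurable_times) auto
  have "L1_plus_Linf_norm mu (DE n f g mu) \<le> L1_norm mu (\<lambda>x. 0) + Linf_norm mu (DE n f g mu)"
    unfolding L1_plus_Linf_norm_def
    using meas by (intro INF_lower2[of "(\<lambda>x. 0, DE n f g mu)"]) auto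
  also have "\<dots> \<le> 1" using le by (simp add: L1_norm_def)
  also have "(1::ennreal) \<le> 2" by simp
  finally show ?thesis .
qed

text \<open>Centring at most doubles the bound 1, because \<open>mu\<close> is a probability
  measure.\<close>

lemma convex_cyl_DE_tilde:
  assumes "convex_cyl n f g" "mu \<in> Pac lam"
  shows "Linf_norm mu (DE_tilde n f g mu) \<le> 2"
proof -
  interpret prob_space mu using assms(2) by (intro prob_spaceI) (simp add: Pac_def)
  have "\<bar>f i x - (\<integral>y. f i y \<partial>mu)\<bar> \<le> 2" if "i < n" for i x
  proof -
    have bd: "\<bar>f i y\<bar> \<le> 1" for y using assms(1) that by (auto simp: convex_cyl_def)
    have "\<bar>\<integral>y. f i y \<partial>mu\<bar> \<le> (\<integral>y. \<bar>f i y\<bar> \<partial>mu)" by (rule integral_abs_bound)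
    also have "\<dots> \<le> (\<integral>y. 1 \<partial>mu)" using bd by (intro integral_mono') auto
    finally have "\<bar>\<integral>y. f i y \<partial>mu\<bar> \<le> 1" by (simp add: prob_space)
    then show ?thesis using bd[of x] by linarith
  qed
  then have "\<bar>DE_tilde n f g mu x\<bar> \<le> 2" for x
    unfolding DE_tilde_def using assms(1)
    by (intro abs_weighted_sum_le) (auto simp: convex_cyl_def)
  then show ?thesis
    using Linf_norm_le[where mu = mu and c = 2 and k = "DE_tilde n f g mu"] by simp
qed

text \<open>The derivative norm and the sup norm each enter as \<open>2^2\<close>, whence
  \<open>8 * C\<close>.\<close>

lemma energy_bound_from_norms:
  fixes X :: "'b \<Rightarrow> ennreal"
  assumes "0 < C" "ennreal e \<le> ennreal C * ((SUP mu\<in>A. (X mu)^2) + s^2)"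
    and "\<And>mu. mu \<in> A \<Longrightarrow> X mu \<le> 2" "s \<le> 2"
  shows "e \<le> 8 * C"
proof -
  have "(SUP mu\<in>A. (X mu)^2) \<le> 2^2"
    using assms(3) by (intro SUP_least power_mono) auto
  moreover have "s^2 \<le> 2^2" using assms(4) by (intro power_mono) auto
  ultimately have "ennreal e \<le> ennreal C * (2^2 + 2^2)"
    using assms(2) by (meson add_mono mult_left_mono order_trans zero_le)
  also have "\<dots> = ennreal (8 * C)"
    using assms(1) by (simp add: ennreal_mult mult.commute)
  finally show ?thesis using assms(1) by (subst (asm) ennreal_le_iff) auto
qed

context reference_measure
begin

text \<open>The alternatives of the theorem enter only through \<open>bound\<close>. Most of the
  proof builds the compact nest. Points are separated by the continuous functions
  \<open>arctan (mu(f j))\<close>, so the exceptional set is empty.\<close>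

lemma quasi_regular_Mac:
  fixes Lam :: "'a measure measure"
  assumes Lam_borel: "sets Lam = sets (borel_of (Mac_top lam))" and Lam_prob: "prob_space Lam"
    and dform: "sym_dirichlet_form Lam E D"
    and qc_dense: "has_dense_qc_subspace (Mac_top lam) Lam E D"
    and bound: "\<And>n f g. convex_cyl n f g \<Longrightarrow> cyl f g \<in> D \<and> E (cyl f g) (cyl f g) \<le> B"
  shows "quasi_regular (Mac_top lam) Lam E D"
proof -
  interpret dirichlet_form Lam E D by unfold_locales fact
  interpret Lam: prob_space Lam by fact
  have sp: "space Lam = Mac lam"
    using sets_eq_imp_space_eq[OF Lam_borel] by (simp add: Mac_top_eq)
  obtain f :: "nat \<Rightarrow> 'a \<Rightarrow> real" where f: "\<And>i. continuous_on UNIV (f i)" "\<And>i x. \<bar>f i x\<bar> \<le> 1"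
    and f_sup: "\<And>mu nu e. mu \<in> Mac lam \<Longrightarrow> nu \<in> Mac lam \<Longrightarrow> 0 < e \<Longrightarrow>
      \<exists>i. rho_var lam mu nu - e < (\<integral>x. f i x \<partial>mu) - (\<integral>x. f i x \<partial>nu)"
    using rho_var_eq_Sup_family by metis
  have f_borel: "f i \<in> borel_measurable borel" for i
    by (intro borel_measurable_continuous_onI f)
  obtain nu :: "nat \<Rightarrow> 'a measure" where nu: "\<And>k. nu k \<in> Mac lam"
    and nu_dense: "\<And>mu e. mu \<in> Mac lam \<Longrightarrow> 0 < e \<Longrightarrow> \<exists>k. rho_var lam mu (nu k) < e"
    using Mac_separable by metis
  define c where "c k j = (\<integral>x. f j x \<partial>nu k)" for k j
  \<comment> \<open>\<open>X n m\<close> smooths \<open>U n\<close>, the \<open>arctan\<close> of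
    the distance to the first \<open>n+1\<close> points of the dense sequence.\<close>
  define X where "X n m = cyl f (\<lambda>x. arctan (softminmax n (Suc m) c x))" for n m
  define r where "r n mu = Min ((\<lambda>k. rho_var lam mu (nu k)) ` {..n})" for n mu
  define U where "U n mu = arctan (r n mu)" for n mu
  have arctan_le: "\<bar>arctan y\<bar> \<le> 2" for y
    using arctan_bounded[of y] pi_less_4 by (auto simp: abs_le_iff)
  have XD: "X n m \<in> D" and XE: "E (X n m) (X n m) \<le> B" for n m
    using bound[OF convex_cyl_arctan_softminmax[of "Suc m" f n c]] f by (auto simp: X_def)
  have X_bd: "\<bar>X n m mu\<bar> \<le> 2" for n m mu by (simp add: X_def cyl_def arctan_le)
  have XE1: "E1 Lam E (X n m) (X n m) \<le> B + 4" for n m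
  proof -
    have "(\<integral>x. X n m x * X n m x \<partial>Lam) \<le> (\<integral>x. 4 \<partial>Lam)"
    proof (rule integral_mono')
      fix x
      have "\<bar>X n m x * X n m x\<bar> \<le> 2 * 2" unfolding abs_mult using X_bd by (intro mult_mono) auto
      then show "X n m x * X n m x \<le> 4" by simp
    qed auto
    then show ?thesis using XE[of n m] by (simp add: E1_def Lam.prob_space)
  qed
  have X_lim: "(\<lambda>m. X n m mu) \<longlonglongrightarrow> U n mu" if mu: "mu \<in> space Lam" for n mu
    unfolding X_def cyl_def U_def r_def
  proof (intro tendsto_arctan softminmax_tendsto)
    have mu: "mu \<in> Mac lam" using mu sp by simp
    show "(\<integral>x. f j x \<partial>mu) - c k j \<le> rho_var lam mu (nu k)" for k j
      using integral_diff_le_rho_var[OF mu nu f_borel f(2), of j k] by (simp add: c_def)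
    show "\<exists>j. rho_var lam mu (nu k) - e < (\<integral>x. f j x \<partial>mu) - c k j" if "0 < e" for k e
      using f_sup[OF mu nu that] by (simp add: c_def)
  qed
  have UD: "U n \<in> D" and UE1: "E1 Lam E (U n) (U n) \<le> 2 * (B + 4)" for n
    using bounded_limit_in_D[OF Lam.finite_measure_axioms, of "X n" "B + 4" 2 "U n"]
      XD XE1 X_bd X_lim by auto
  have r_nn: "0 \<le> r n mu" for n mu unfolding r_def by (auto simp: Min_ge_iff)
  have U_nn: "0 \<le> U n mu" for n mu using r_nn by (simp add: U_def)
  have U_bd: "\<bar>U n mu\<bar> \<le> 2" for n mu by (simp add: U_def arctan_le)
  have U_anti: "U j mu \<le> U i mu" if "i \<le> j" for i j mu
    unfolding U_def r_def arctan_le_iff using that by (intro Min_antimono image_mono) auto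
  have U_lim: "(\<lambda>n. U n mu) \<longlonglongrightarrow> 0" if mu: "mu \<in> space Lam" for mu
  proof -
    have "(\<lambda>n. r n mu) \<longlonglongrightarrow> 0"
    proof (rule LIMSEQ_I)
      fix e :: real assume "0 < e"
      then obtain k where k: "rho_var lam mu (nu k) < e" using nu_dense mu sp by blast
      have "norm (r n mu - 0) < e" if "k \<le> n" for n
      proof -
        have "r n mu \<le> rho_var lam mu (nu k)" unfolding r_def using that by (intro Min_le) auto
        then show ?thesis using k r_nn[of n mu] by simp
      qed
      then show "\<exists>no. \<forall>n\<ge>no. norm (r n mu - 0) < e" by blast
    qed
    from tendsto_arctan[OF this] show ?thesis by (simp add: U_def)
  qed
  obtain w where w: "\<And>n. w n \<in> midpoint_hull U n"
      "(\<lambda>n. E1 Lam E (fdiff (w n) (\<lambda>_. 0)) (fdiff (w n) (\<lambda>_. 0))) \<longlonglongrightarrow> 0"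
    using bounded_limit_in_D(3)[OF Lam.finite_measure_axioms, of U "2 * (B + 4)" 2 "\<lambda>_. 0"]
      UD UE1 U_bd U_lim by auto
  have w_lim: "(\<lambda>n. E1 Lam E (w n) (w n)) \<longlonglongrightarrow> 0" using w(2) by (simp add: fdiff_def)
  have wD: "w n \<in> D" for n using w(1) UD by (rule midpoint_hull_D)
  have w_nn: "0 \<le> w n mu" for n mu
    using midpoint_hull_between(1)[OF w(1), of n 0 mu 2] U_nn U_bd by (auto simp: abs_le_iff)
  define d where "d j = 1 / real (Suc j)" for j
  have d_pos: "0 < d j" for j by (simp add: d_def)
  define a where "a j = arctan (d j)" for j
  have a_pos: "0 < a j" for j using d_pos by (simp add: a_def)
  \<comment> \<open>The threshold anticipates division by \<open>a j\<close>: the scaled function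
    then has energy below \<open>(1/8)^j\<close>.\<close>
  have "\<exists>N. E1 Lam E (w N) (w N) < (1/8)^j * (a j)\<^sup>2" for j
  proof -
    have "eventually (\<lambda>n. E1 Lam E (w n) (w n) < (1/8)^j * (a j)\<^sup>2) sequentially"
      using a_pos[of j] by (intro order_tendstoD(2)[OF w_lim]) simp
    then show ?thesis by (auto simp: eventually_sequentially)
  qed
  then obtain N where N: "\<And>j. E1 Lam E (w (N j)) (w (N j)) < (1/8)^j * (a j)\<^sup>2" by metis
  have "\<exists>K. \<forall>mu\<in>Mac lam. U K mu \<le> w (N j) mu" for j
    using w(1) U_anti by (rule midpoint_hull_ge_member)
  then obtain K where K: "\<And>j mu. mu \<in> Mac lam \<Longrightarrow> U (K j) mu \<le> w (N j) mu" by metis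
  define v where "v j = (\<lambda>mu. (1 / a j) * w (N j) mu)" for j
  \<comment> \<open>\<open>Q j\<close> collects the measures farther than \<open>d j\<close> from
    the first \<open>K j + 1\<close> dense points. There \<open>U (K j)\<close> is at least
    \<open>arctan (d j) = a j\<close>, so \<open>v j\<close> is at least 1.\<close>
  define Q where "Q j = Mac lam - (\<Union>k\<in>{..K j}. mcball (nu k) (d j))" for j
  define F where "F n = topspace mtopology - (\<Union>j\<in>{n..}. Q j)" for n
  have nestF: "nest mtopology Lam E D F"
    unfolding F_def
  proof (rule nest_of_small_sets[where v = v])
    show "openin mtopology (Q j)" for j
      unfolding Q_def
      using openin_topspace[of mtopology] by (intro openin_diff closedin_Union) auto
    show "space Lam = topspace mtopology" using sp by simp
    show "v j \<in> D" for j unfolding v_def by (intro D_scale wD)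
    show "E1 Lam E (v j) (v j) \<le> (1/8)^j" for j
      unfolding v_def E1_scale_both[OF wD] using N[of j] a_pos[of j]
      by (simp add: power_divide divide_simps)
    show "0 \<le> v j mu" for j mu using w_nn a_pos by (simp add: v_def less_imp_le)
    show "1 \<le> v j mu" if "mu \<in> Q j" for j mu
    proof -
      have mu: "mu \<in> Mac lam" and far: "\<And>k. k \<le> K j \<Longrightarrow> d j < rho_var lam mu (nu k)"
        using that nu commute by (auto simp: Q_def in_mcball not_le)
      have "d j \<le> r (K j) mu"
        unfolding r_def using far by (auto simp: Min_ge_iff less_imp_le)
      then have "a j \<le> U (K j) mu" by (simp add: a_def U_def arctan_le_iff)
      also have "\<dots> \<le> w (N j) mu" using K[OF mu] .
      finally show ?thesis using a_pos[of j] by (simp add: v_def)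
    qed
  qed
  have F_closed: "closedin mtopology (F n)" for n using nestF by (simp add: nest_def)
  have F_tb: "mtotally_bounded (F n)" for n
    unfolding mtotally_bounded_def
  proof (intro allI impI)
    fix e :: real assume e: "0 < e"
    obtain j0 where j0: "1 / real (Suc j0) < e / 2"
      using nat_approx_posE[of "e/2"] e by auto
    \<comment> \<open>\<open>F n\<close> is built to miss \<open>Q j\<close> for
      \<open>j \<ge> n\<close>, and \<open>j \<ge> j0\<close> makes the radius less than
      \<open>e/2\<close>.\<close>
    define j where "j = max j0 n"
    have "d j \<le> 1 / real (Suc j0)" unfolding d_def j_def by (intro divide_left_mono) auto
    then have dj: "d j < e / 2" using j0 by simp
    have F_sub: "F n \<subseteq> (\<Union>k\<in>{..K j}. mcball (nu k) (d j))"
      by (auto simp: F_def Q_def j_def)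
    \<comment> \<open>The centres \<open>nu k\<close> may lie outside \<open>F n\<close>, while
      \<open>mtotally_bounded\<close> asks for centres inside. Replacing each by a point of
      \<open>F n\<close> in its ball doubles the radius, hence the choice
      \<open>d j < e/2\<close>.\<close>
    let ?I = "{k \<in> {..K j}. F n \<inter> mcball (nu k) (d j) \<noteq> {}}"
    define p where "p k = (SOME y. y \<in> F n \<inter> mcball (nu k) (d j))" for k
    have p: "p k \<in> F n \<inter> mcball (nu k) (d j)" if "k \<in> ?I" for k
      unfolding p_def using that some_in_eq[of "F n \<inter> mcball (nu k) (d j)"] by auto
    show "\<exists>K. finite K \<and> K \<subseteq> F n \<and> F n \<subseteq> (\<Union>x\<in>K. mball x e)"
    proof (intro exI conjI)
      show "finite (p ` ?I)" by simp
      show "p ` ?I \<subseteq> F n" using p by blast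
      show "F n \<subseteq> (\<Union>x\<in>p ` ?I. mball x e)"
      proof
        fix x assume x: "x \<in> F n"
        then obtain k where k: "k \<in> ?I" "x \<in> mcball (nu k) (d j)" using F_sub by blast
        have "rho_var lam (p k) x \<le> rho_var lam (p k) (nu k) + rho_var lam (nu k) x"
          using p[OF k(1)] k(2) by (intro triangle) auto
        also have "\<dots> < e"
          using p[OF k(1)] k(2) dj by (auto simp: commute)
        finally show "x \<in> (\<Union>x\<in>p ` ?I. mball x e)"
          using p[OF k(1)] k by auto
      qed
    qed
  qed
  have F_compact: "compactin mtopology (F n)" for n
    using mtotally_bounded_eq_compact_closure_of[OF Mac_complete, of "F n"] F_tb[of n]
      closure_of_closedin[OF F_closed[of n]] by simp
  \<comment> \<open>With one row, one functional and zero offset, \<open>softminmax\<close> is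
    coordinate 0, and filling every slot with \<open>f j\<close> places \<open>mu(f j)\<close>
    there. This gives \<open>arctan (mu(f j))\<close> the form that \<open>bound\<close>
    covers.\<close>
  define s where "s j = cyl (\<lambda>i. f j) (\<lambda>x. arctan (softminmax 0 1 (\<lambda>_ _. 0) x))" for j
  have s_eq: "s j mu = arctan (\<integral>x. f j x \<partial>mu)" for j mu
    by (simp add: s_def cyl_def softminmax_def lse_weight_def ln_inverse)
  have s_D: "s j \<in> D" for j
    unfolding s_def using bound[OF convex_cyl_arctan_softminmax] f by simp
  have s_qc: "quasi_continuous mtopology Lam E D (s j)" for j
  proof (rule continuous_imp_quasi_continuous)
    have "continuous_map mtopology euclideanreal (arctan \<circ> (\<lambda>mu. \<integral>x. f j x \<partial>mu))"
      by (rule continuous_map_compose[OF continuous_map_integral_Mac[OF f_borel f(2)]])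
        (simp add: continuous_on_arctan continuous_on_id)
    then show "continuous_map mtopology euclideanreal (s j)"
      by (simp add: o_def s_eq[abs_def])
  qed
  have s_sep: "\<exists>j. s j mu \<noteq> s j nu" if sep: "mu \<in> Mac lam" "nu \<in> Mac lam" "mu \<noteq> nu" for mu nu
  proof -
    have "0 < rho_var lam mu nu" using sep by simp
    then obtain j where "(\<integral>x. f j x \<partial>mu) - (\<integral>x. f j x \<partial>nu) > 0"
      using f_sup[OF sep(1,2), of "rho_var lam mu nu"] by auto
    then show ?thesis by (intro exI[of _ j]) (simp add: s_eq arctan_eq_iff)
  qed
  show ?thesis
    unfolding quasi_regular_def Mac_top_eq
  proof (intro conjI)
    show "\<exists>K. nest mtopology Lam E D K \<and> (\<forall>n. compactin mtopology (K n))"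
      using nestF F_compact by blast
    show "has_dense_qc_subspace mtopology Lam E D" using qc_dense by (simp add: Mac_top_eq)
    show "\<exists>Z (u :: nat \<Rightarrow> 'a measure \<Rightarrow> real). cap1 mtopology Lam E D Z = 0 \<and>
        (\<forall>n. u n \<in> D \<and> quasi_continuous mtopology Lam E D (u n)) \<and>
        (\<forall>x\<in>topspace mtopology - Z. \<forall>y\<in>topspace mtopology - Z. x \<noteq> y \<longrightarrow> (\<exists>n. u n x \<noteq> u n y))"
      using s_D s_qc s_sep by (intro exI[of _ "{}"] exI[of _ s]) (simp add: cap1_empty)
  qed
qed

end

theorem theorem2p5:
  fixes lam :: "'a::polish_space measure"
    and Lam :: "'a measure measure"
    and E :: "('a measure \<Rightarrow> real) \<Rightarrow> ('a measure \<Rightarrow> real) \<Rightarrow> real"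
    and D :: "('a measure \<Rightarrow> real) set"
  assumes lam_borel: "sets lam = sets borel"
    and lam_sigma: "sigma_finite_measure lam"
    and lam_radon: "radon_measure lam"
    and lam_nonzero: "emeasure lam (space lam) \<noteq> 0"
    and Lam_borel: "sets Lam = sets (borel_of (Mac_top lam))"
    and Lam_prob: "prob_space Lam"
    and dform: "sym_dirichlet_form Lam E D"
    and qc_dense: "has_dense_qc_subspace (Mac_top lam) Lam E D"
    and cond: "(\<exists>C>0. \<forall>n f g. cyl_data n f g \<longrightarrow>
                  cyl f g \<in> D \<and>
                  ennreal (E (cyl f g) (cyl f g)) \<le> ennreal C *
                    ((SUP mu\<in>Mac lam. (L1_plus_Linf_norm mu (DE n f g mu))^2)
                     + (sup_norm fin_meas (cyl f g))^2))
             \<or> (emeasure Lam (Pac lam) = 1 \<and>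
                (\<exists>C>0. \<forall>n f g. cyl_data n f g \<longrightarrow>
                  cyl f g \<in> D \<and>
                  ennreal (E (cyl f g) (cyl f g)) \<le> ennreal C *
                    ((SUP mu\<in>Pac lam. (Linf_norm mu (DE_tilde n f g mu))^2)
                     + (sup_norm fin_meas (cyl f g))^2)))"
  shows "quasi_regular (Mac_top lam) Lam E D \<and>
         ((emeasure Lam (Pac lam) = 1 \<and>
           (\<exists>C>0. \<forall>n f g. cyl_data n f g \<longrightarrow>
              cyl f g \<in> D \<and>
              ennreal (E (cyl f g) (cyl f g)) \<le> ennreal C *
                ((SUP mu\<in>Pac lam. (Linf_norm mu (DE_tilde n f g mu))^2)
                 + (sup_norm fin_meas (cyl f g))^2)))
          \<longrightarrow> (let Pt = subtopology (Mac_top lam) (Pac lam);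
                   LP = restrict_space Lam (Pac lam);
                   ext = (\<lambda>v x. if x \<in> Pac lam then v x else 0);
                   DP = {v. ext v \<in> D};
                   EP = (\<lambda>v w. E (ext v) (ext w))
               in sym_dirichlet_form LP EP DP \<and> quasi_regular Pt LP EP DP))"
proof -
  interpret reference_measure lam
    using lam_sigma lam_borel by (simp add: reference_measure_def reference_measure_axioms_def)
  interpret Lam: prob_space Lam by fact
  \<comment> \<open>Either alternative yields \<open>B = 8 * C\<close>, and quasi-regularity on
    \<open>Mac lam\<close> is then proved for both at once.\<close>
  from cond obtain B where B: "\<And>n f g. convex_cyl n f g \<Longrightarrow>
      cyl f g \<in> D \<and> E (cyl f g) (cyl f g) \<le> B"
  proof (elim disjE conjE exE)
    fix C :: real assume "0 < C" and *: "\<forall>n f g. cyl_data n f g \<longrightarrow> cyl f g \<in> D \<and>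
        ennreal (E (cyl f g) (cyl f g)) \<le> ennreal C *
          ((SUP mu\<in>Mac lam. (L1_plus_Linf_norm mu (DE n f g mu))^2) + (sup_norm fin_meas (cyl f g))^2)"
    show thesis
    proof (rule that[of "8 * C"])
      fix n g and f :: "nat \<Rightarrow> 'a \<Rightarrow> real" assume c: "convex_cyl n f g"
      then have cyl: "cyl_data n f g" by (simp add: convex_cyl_def)
      show "cyl f g \<in> D \<and> E (cyl f g) (cyl f g) \<le> 8 * C"
        using *[rule_format, OF cyl] energy_bound_from_norms[OF \<open>0 < C\<close> conjunct2[OF *[rule_format, OF cyl]]
            convex_cyl_DE[OF c] convex_cyl_sup_norm[OF c]] by simp
    qed
  next
    fix C :: real assume "0 < C" and *: "\<forall>n f g. cyl_data n f g \<longrightarrow> cyl f g \<in> D \<and>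
        ennreal (E (cyl f g) (cyl f g)) \<le> ennreal C *
          ((SUP mu\<in>Pac lam. (Linf_norm mu (DE_tilde n f g mu))^2) + (sup_norm fin_meas (cyl f g))^2)"
    show thesis
    proof (rule that[of "8 * C"])
      fix n g and f :: "nat \<Rightarrow> 'a \<Rightarrow> real" assume c: "convex_cyl n f g"
      then have cyl: "cyl_data n f g" by (simp add: convex_cyl_def)
      show "cyl f g \<in> D \<and> E (cyl f g) (cyl f g) \<le> 8 * C"
        using *[rule_format, OF cyl] energy_bound_from_norms[OF \<open>0 < C\<close> conjunct2[OF *[rule_format, OF cyl]]
            convex_cyl_DE_tilde[OF c] convex_cyl_sup_norm[OF c]] by simp
    qed
  qed
  have qr: "quasi_regular (Mac_top lam) Lam E D"
    using quasi_regular_Mac[OF Lam_borel Lam_prob dform qc_dense B] .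
  \<comment> \<open>Unfolding \<open>ext0\<close> turns this into the \<open>let\<close> expression
    of the statement.\<close>
  have restr: "sym_dirichlet_form (restrict_space Lam (Pac lam))
        (\<lambda>v w. E (ext0 (Pac lam) v) (ext0 (Pac lam) w)) {v. ext0 (Pac lam) v \<in> D} \<and>
      quasi_regular (subtopology (Mac_top lam) (Pac lam)) (restrict_space Lam (Pac lam))
        (\<lambda>v w. E (ext0 (Pac lam) v) (ext0 (Pac lam) w)) {v. ext0 (Pac lam) v \<in> D}"
    if full: "emeasure Lam (Pac lam) = 1"
  proof -
    have cl: "closedin (Mac_top lam) (Pac lam)" using Pac_closed by (simp add: Mac_top_eq)
    have "AE mu in Lam. mu \<in> Pac lam"
      using full by (intro Lam.AE_prob_1) (simp add: Lam.emeasure_eq_measure)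
    then interpret dirichlet_form_full_set Lam E D "Pac lam"
      using dform closedin_sets_borel_of[OF cl] Lam_borel by unfold_locales auto
    show ?thesis
      using sym_dirichlet_form_restrict quasi_regular_restrict[OF qr cl] by blast
  qed
  show ?thesis
    using qr restr unfolding Let_def ext0_def by blast
qed

end
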